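(* Consider the randomized gossip algorithm with unreliable communication on $n\ge 3$ nodes, with node pair selection matrix $A=[a_{ij}]$ and communication probabilities $\{P_k^+\}_{k\ge0},\{P_k^-\}_{k\ge0}$ (as defined in the context). Suppose that the underlying digraph $\mathcal{G}_0$ is weakly connected and that communication is perfectly dependent, i.e. for every $k$ the events $\mathbb{E}_k^+$ and $\mathbb{E}_k^-$ coincide up to a set of probability zero; write $P_k=P_k^+=P_k^-$. Then global a.s. $\epsilon$-consensus is achieved if and only if there exist a constant $p_\ast>0$ and an integer $T_\ast\ge1$ such that $\sum_{k=m}^{m+T_\ast-1}P_k\ge p_\ast$ for all $m\ge0$. In fact, for such $p_\ast,T_\ast$, $$T_{\rm com}(\epsilon)\le 3\Big[\log\Big(1-\frac{\lambda_2^\ast p_\ast}{2nT_\ast}\Big)^{-1}\Big]^{-1}\log\epsilon^{-1}+O(1),$$ where $\lambda_2^\ast$ is the second smallest eigenvalue of $D-(A+A^T)$, with $D=\mathrm{diag}(d_1,\dots,d_n)$ and $d_i=\sum_{j=1}^n(a_{ij}+a_{ji})$.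
   Context: Network model. The node set is $\mathcal{V}=\{1,\dots,n\}$, $n\ge3$. $A=[a_{ij}]\in\mathbb{R}^{n\times n}$ is a stochastic matrix (nonnegative entries, each row sums to $1$). The underlying digraph is $\mathcal{G}_0=(\mathcal{V},\mathcal{E}_0)$ with $(j,i)\in\mathcal{E}_0$ if and only if $a_{ij}>0$. A digraph is weakly connected if it is connected as an undirected graph when arc directions are ignored. Node pair selection process. Independently at each time $k=0,1,2,\dots$, a node $i\in\mathcal{V}$ is drawn with probability $1/n$, and then node $i$ picks the (ordered) pair $(i,j)$ with probability $a_{ij}$. Node communication process. $\{P_k^+\}_{k\ge0}$ and $\{P_k^-\}_{k\ge0}$ are deterministic sequences in $[0,1]$. Independently over time, and independently of the node states and of the node pair selection process, $\mathbf{P}(\mathbb{E}_k^+)=P_k^+$ and $\mathbf{P}(\mathbb{E}_k^-)=P_k^-$, where $\mathbb{E}_k^+$ is the event that node $i$ receives $x_j(k)$ when $(i,j)$ is selected at time $k$, and $\mathbb{E}_k^-$ is the event that node $j$ receives $x_i(k)$ when $(i,j)$ is selected at time $k$. Algorithm. Let $k_0\ge0$ be an arbitrary integer initial time and $x(k_0)=x^0\in\mathbb{R}^n$ a deterministic initial condition. For $k\ge k_0$, $x_i(k+1)=\frac12x_i(k)+\frac12x_j(k)$ if $(i,j)$ or $(j,i)$ is selected at time $k$ and $i$ receives $x_j(k)$; otherwise $x_i(k+1)=x_i(k)$. $\epsilon$-consensus. Let $\mathcal{H}(k)=\max_i x_i(k)-\min_i x_i(k)$. The $\epsilon$-computation time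 is $$T_{\rm com}(\epsilon)=\sup_{k_0,\,x(k_0)}\inf\Big\{k-k_0:\ \mathbf{P}\Big(\frac{\mathcal{H}(k)}{\mathcal{H}(k_0)}\ge\epsilon\Big)\le\epsilon\Big\},$$ the supremum being over integers $k_0\ge0$ and initial conditions $x(k_0)\in\mathbb{R}^n$ with $\mathcal{H}(k_0)>0$. Global a.s. $\epsilon$-consensus is achieved if $T_{\rm com}(\epsilon)=O(\log\epsilon^{-1})$, where by definition $f(\epsilon)=O(g(\epsilon))$ means that $\limsup_{\epsilon\to0}f(\epsilon)/g(\epsilon)<\infty$ is a nonzero constant. In the displayed bound, $O(1)$ denotes a term that stays bounded as $\epsilon\to0$. *)

theory Defs
  imports "HOL-Probability.Probability" "HOL-Library.Landau_Symbols"
begin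

section \<open>Network\<close>

text \<open>Nodes are the elements of a finite type \<open>'n\<close>; \<open>A $ i $ j\<close> is the entry \<open>a\<^sub>i\<^sub>j\<close>.\<close>

definition stochastic_matrix :: "real ^ 'n ^ 'n \<Rightarrow> bool" where
  "stochastic_matrix A \<longleftrightarrow> (\<forall>i j. 0 \<le> A $ i $ j) \<and> (\<forall>i. (\<Sum>j\<in>UNIV. A $ i $ j) = 1)"

text \<open>Note the orientation: a positive entry \<open>a\<^sub>i\<^sub>j\<close> gives an arc from \<open>j\<close> to \<open>i\<close>.\<close>

definition underlying_digraph :: "real ^ 'n ^ 'n \<Rightarrow> ('n \<times> 'n) set" where
  "underlying_digraph A = {(j, i). A $ i $ j > 0}"

definition weakly_connected :: "('n \<times> 'n) set \<Rightarrow> bool" where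
  "weakly_connected E \<longleftrightarrow> (\<forall>u v. (u, v) \<in> (E \<union> E\<inverse>)\<^sup>*)"

section \<open>Second smallest eigenvalue of the associated Laplacian\<close>

definition gossip_laplacian :: "real ^ 'n ^ 'n \<Rightarrow> real ^ 'n ^ 'n" where
  "gossip_laplacian A =
     (\<chi> i j. if i = j then \<Sum>l\<in>UNIV. A $ i $ l + A $ l $ i else 0) - (A + transpose A)"

definition eigenspace :: "real ^ 'n ^ 'n \<Rightarrow> real \<Rightarrow> (real ^ 'n) set" where
  "eigenspace L \<mu> = {v. L *v v = \<mu> *\<^sub>R v}"

definition eigenvalues :: "real ^ 'n ^ 'n \<Rightarrow> real set" where
  "eigenvalues L = {\<mu>. \<exists>v\<in>eigenspace L \<mu>. v \<noteq> 0}"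

text \<open>
  The real eigenvalues in increasing order, each repeated according to its geometric multiplicity.
  It is only used for symmetric matrices, where all eigenvalues are real and geometric and
  algebraic multiplicities agree, so that the list has length \<open>CARD('n)\<close>.
\<close>

definition eigenvalue_list :: "real ^ 'n ^ 'n \<Rightarrow> real list" where
  "eigenvalue_list L =
     concat (map (\<lambda>\<mu>. replicate (dim (eigenspace L \<mu>)) \<mu>) (sorted_list_of_set (eigenvalues L)))"

definition second_smallest_eigenvalue :: "real ^ 'n ^ 'n \<Rightarrow> real" where
  "second_smallest_eigenvalue L = eigenvalue_list L ! 1"

section \<open>Random node pair selection and unreliable communication\<close>

text \<open>
  \<open>sel k\<close> is the ordered pair selected at time \<open>k\<close>.  When it is \<open>(i, j)\<close>, node \<open>i\<close> receives the
  state of \<open>j\<close> on the event \<open>Ep k\<close>, and \<open>j\<close> receives the state of \<open>i\<close> on the event \<open>Em k\<close>.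
  Assumption \<open>indep\<close> says that the sigma-algebras generated by the selections at the different
  times, and those generated by the communication events at the different times, are all mutually
  independent.
  The joint law of \<open>Ep k\<close> and \<open>Em k\<close> at one time \<open>k\<close> is left unspecified.  Since the state at
  time \<open>k\<close> is a function of the selections and communications before \<open>k\<close> and of a deterministic
  initial value, its independence from the communication at time \<open>k\<close> follows.
\<close>

locale unreliable_gossip = prob_space M
  for M :: "'w measure" +
  fixes A :: "real ^ 'n ^ 'n"
    and Pp Pm :: "nat \<Rightarrow> real"
    and sel :: "nat \<Rightarrow> 'w \<Rightarrow> 'n \<times> 'n"
    and Ep Em :: "nat \<Rightarrow> 'w set"
  assumes stochastic: "stochastic_matrix A"
    and Pp_range: "Pp k \<in> {0..1}"
    and Pm_range: "Pm k \<in> {0..1}"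
    and sel_prob:
      "prob {\<omega> \<in> space M. sel k \<omega> = (i, j)} = 1 / real CARD('n) * A $ i $ j"
    and sel_rv: "random_variable (count_space UNIV) (sel k)"
    and Ep_event: "Ep k \<in> events"
    and Em_event: "Em k \<in> events"
    and Ep_prob: "prob (Ep k) = Pp k"
    and Em_prob: "prob (Em k) = Pm k"
    and indep:
      "indep_sets
         (case_sum
            (\<lambda>k. {sel k -` S \<inter> space M | S. True})
            (\<lambda>k. sigma_sets (space M) {Ep k, Em k}))
         (UNIV :: (nat + nat) set)"

definition perfectly_dependent :: "'w measure \<Rightarrow> (nat \<Rightarrow> 'w set) \<Rightarrow> (nat \<Rightarrow> 'w set) \<Rightarrow> bool" where
  "perfectly_dependent M Ep Em \<longleftrightarrow> (\<forall>k. AE \<omega> in M. \<omega> \<in> Ep k \<longleftrightarrow> \<omega> \<in> Em k)"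

section \<open>Gossip algorithm\<close>

text \<open>If \<open>i = j\<close> the update leaves the state unchanged, whichever flags are set.\<close>

definition gossip_step :: "'n \<times> 'n \<Rightarrow> bool \<Rightarrow> bool \<Rightarrow> real ^ 'n \<Rightarrow> real ^ 'n" where
  "gossip_step = (\<lambda>(i, j) rp rm x. \<chi> l.
     if l = i \<and> rp then (1/2) * x $ i + (1/2) * x $ j
     else if l = j \<and> rm then (1/2) * x $ j + (1/2) * x $ i
     else x $ l)"

text \<open>\<open>gossip_state sel Ep Em k0 x0 t \<omega>\<close> is the state at absolute time \<open>k0 + t\<close>.\<close>

primrec gossip_state ::
  "(nat \<Rightarrow> 'w \<Rightarrow> 'n \<times> 'n) \<Rightarrow> (nat \<Rightarrow> 'w set) \<Rightarrow> (nat \<Rightarrow> 'w set) \<Rightarrow>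
   nat \<Rightarrow> real ^ 'n \<Rightarrow> nat \<Rightarrow> 'w \<Rightarrow> real ^ 'n" where
  "gossip_state sel Ep Em k0 x0 0 \<omega> = x0"
| "gossip_state sel Ep Em k0 x0 (Suc t) \<omega> =
     gossip_step (sel (k0 + t) \<omega>) (\<omega> \<in> Ep (k0 + t)) (\<omega> \<in> Em (k0 + t))
       (gossip_state sel Ep Em k0 x0 t \<omega>)"

section \<open>Computation time and consensus\<close>

definition spread :: "real ^ 'n \<Rightarrow> real" where
  "spread x = Max (range (\<lambda>i. x $ i)) - Min (range (\<lambda>i. x $ i))"

text \<open>
  The infimum runs over the elapsed time \<open>t = k - k0\<close> with \<open>k \<ge> k0\<close>.  Values are extended reals:
  the infimum of the empty set and an unbounded supremum are both infinite.
\<close>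

definition T_com ::
  "'w measure \<Rightarrow> (nat \<Rightarrow> 'w \<Rightarrow> 'n::finite \<times> 'n) \<Rightarrow> (nat \<Rightarrow> 'w set) \<Rightarrow> (nat \<Rightarrow> 'w set) \<Rightarrow>
   real \<Rightarrow> ereal" where
  "T_com M sel Ep Em \<epsilon> =
     (SUP (k0, x0) \<in> {(k0, x0). spread x0 > 0}.
        INF t \<in> {t. measure M {\<omega> \<in> space M.
                      spread (gossip_state sel Ep Em k0 x0 t \<omega>) / spread x0 \<ge> \<epsilon>} \<le> \<epsilon>}.
          ereal (real t))"

text \<open>
  \<open>f(\<epsilon>) = O(g(\<epsilon>))\<close> in the sense that the limit superior of \<open>f/g\<close>, for \<open>\<epsilon>\<close> tending to \<open>0\<close>
  from the right, is finite and nonzero; unlike \<open>bigo\<close>, this excludes \<open>f = o(g)\<close>.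
\<close>

definition limsup_order :: "(real \<Rightarrow> ereal) \<Rightarrow> (real \<Rightarrow> real) \<Rightarrow> bool" where
  "limsup_order f g \<longleftrightarrow>
     (\<exists>c::real. c \<noteq> 0 \<and> Limsup (at_right 0) (\<lambda>\<epsilon>. f \<epsilon> / ereal (g \<epsilon>)) = ereal c)"

definition global_as_consensus ::
  "'w measure \<Rightarrow> (nat \<Rightarrow> 'w \<Rightarrow> 'n::finite \<times> 'n) \<Rightarrow> (nat \<Rightarrow> 'w set) \<Rightarrow> (nat \<Rightarrow> 'w set) \<Rightarrow> bool" where
  "global_as_consensus M sel Ep Em \<longleftrightarrow>
     limsup_order (T_com M sel Ep Em) (\<lambda>\<epsilon>. ln (inverse \<epsilon>))"

end

theory Submission
  imports Defs
begin

text \<open>Under perfect dependence every successful exchange preserves the average and lowers the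
  squared deviation \<open>V\<close> from it by \<open>(x\<^sub>i - x\<^sub>j)\<^sup>2 / 2\<close>, so by the variational
  characterisation of the second Laplacian eigenvalue the expectation of \<open>V\<close> contracts at time \<open>k\<close>
  by the factor \<open>1 - \<lambda>\<^sub>2 P\<^sub>k / (2n)\<close>.  Since \<open>V\<close> is comparable with the squared spread, Markov's
  inequality gives the upper bound; the factor \<open>3\<close> is \<open>2\<close> from squaring \<open>\<epsilon>\<close> plus \<open>1\<close> from the
  required probability.  The consensus time is at least of order \<open>ln (1/\<epsilon>)\<close> because a single
  fixed arc may be selected all the time.  If the sums of \<open>P\<^sub>k\<close> over windows are not bounded below,
  there are arbitrarily long windows without any communication with probability at least \<open>1/2\<close>, so
  that the computation time is infinite.\<close>

section \<open>Spectrum of the gossip Laplacian\<close>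

lemma gossip_laplacian_mult:
  fixes A :: "real ^ 'n ^ 'n"
  shows "(gossip_laplacian A *v x) $ i = (\<Sum>j\<in>UNIV. (A $ i $ j + A $ j $ i) * (x $ i - x $ j))"
proof -
  have "(gossip_laplacian A *v x) $ i =
      (\<Sum>j\<in>UNIV. (if i = j then (\<Sum>l\<in>UNIV. A $ i $ l + A $ l $ i) * x $ j else 0)
        - (A $ i $ j + A $ j $ i) * x $ j)"
    unfolding matrix_vector_mult_def gossip_laplacian_def transpose_def
    by (auto intro!: sum.cong simp: algebra_simps)
  also have "\<dots> = (\<Sum>l\<in>UNIV. A $ i $ l + A $ l $ i) * x $ i
      - (\<Sum>j\<in>UNIV. (A $ i $ j + A $ j $ i) * x $ j)"
    by (simp add: sum_subtractf)
  also have "\<dots> = (\<Sum>j\<in>UNIV. (A $ i $ j + A $ j $ i) * (x $ i - x $ j))"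
    by (simp only: sum_distrib_right right_diff_distrib sum_subtractf)
  finally show ?thesis .
qed

text \<open>Exchanging \<open>i\<close> and \<open>j\<close> in the half weighted by
  \<open>A $ j $ i\<close> leaves \<open>A $ i $ j\<close> times
  \<open>x $ i * (x $ i - x $ j) + x $ j * (x $ j - x $ i)\<close>, and this bracket is a square.
  Each ordered pair counts once, so no factor 1/2 appears.\<close>

lemma gossip_laplacian_quadratic:
  fixes A :: "real ^ 'n ^ 'n"
  shows "x \<bullet> (gossip_laplacian A *v x) = (\<Sum>i\<in>UNIV. \<Sum>j\<in>UNIV. A $ i $ j * (x $ i - x $ j)\<^sup>2)"
proof -
  have swap: "(\<Sum>i\<in>UNIV. \<Sum>j\<in>UNIV. A $ j $ i * (x $ i * (x $ i - x $ j))) =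
      (\<Sum>i\<in>UNIV. \<Sum>j\<in>UNIV. A $ i $ j * (x $ j * (x $ j - x $ i)))"
    by (rule sum.swap)
  have "x \<bullet> (gossip_laplacian A *v x) =
      (\<Sum>i\<in>UNIV. \<Sum>j\<in>UNIV. A $ i $ j * (x $ i * (x $ i - x $ j)))
      + (\<Sum>i\<in>UNIV. \<Sum>j\<in>UNIV. A $ j $ i * (x $ i * (x $ i - x $ j)))"
    unfolding inner_vec_def sum.distrib[symmetric]
    by (auto intro!: sum.cong simp: gossip_laplacian_mult sum_distrib_left algebra_simps)
  also have "\<dots> = (\<Sum>i\<in>UNIV. \<Sum>j\<in>UNIV. A $ i $ j * (x $ i - x $ j)\<^sup>2)"
    unfolding swap sum.distrib[symmetric]
    by (auto intro!: sum.cong simp: power2_eq_square algebra_simps)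
  finally show ?thesis .
qed

section \<open>Eigenvalues of symmetric matrices and the Rayleigh quotient\<close>

lemma symmetric_matrix_inner:
  fixes L :: "real ^ 'n ^ 'n"
  assumes "transpose L = L"
  shows "x \<bullet> (L *v y) = (L *v x) \<bullet> y"
  using assms by (metis dot_lmul_matrix vector_transpose_matrix)

lemma transpose_gossip_laplacian: "transpose (gossip_laplacian A) = gossip_laplacian A"
  by (simp add: gossip_laplacian_def transpose_def vec_eq_iff)

text \<open>Eigenvectors of a symmetric matrix for distinct eigenvalues are orthogonal, so choosing
  one per eigenvalue gives an independent, hence finite, set. Finiteness makes
  \<open>sorted_list_of_set\<close> in \<open>eigenvalue_list\<close> list every eigenvalue.\<close>

lemma finite_eigenvalues:
  fixes L :: "real ^ 'n ^ 'n"
  assumes sym: "transpose L = L"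
  shows "finite (eigenvalues L)"
proof -
  define f where "f \<mu> = (SOME v. v \<in> eigenspace L \<mu> \<and> v \<noteq> 0)" for \<mu>
  have f: "L *v f \<mu> = \<mu> *\<^sub>R f \<mu>" "f \<mu> \<noteq> 0" if "\<mu> \<in> eigenvalues L" for \<mu>
    using someI_ex[of "\<lambda>v. v \<in> eigenspace L \<mu> \<and> v \<noteq> 0"] that
    unfolding f_def eigenvalues_def eigenspace_def by blast+
  have orth: "f \<mu> \<bullet> f \<nu> = 0" if "\<mu> \<in> eigenvalues L" "\<nu> \<in> eigenvalues L" "\<mu> \<noteq> \<nu>" for \<mu> \<nu>
    using symmetric_matrix_inner[OF sym, of "f \<mu>" "f \<nu>"] f[OF that(1)] f[OF that(2)] that(3)
    by simp
  have "inj_on f (eigenvalues L)"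
    by (rule inj_onI) (metis f(2) inner_eq_zero_iff orth)
  moreover have "independent (f ` eigenvalues L)"
    by (rule pairwise_orthogonal_independent) (auto simp: pairwise_def orthogonal_def f intro!: orth)
  then have "finite (f ` eigenvalues L)"
    by (rule independent_imp_finite)
  ultimately show ?thesis
    using finite_imageD by blast
qed

text \<open>Compactness yields a minimiser \<open>v\<close> of the Rayleigh quotient on the unit
  sphere of the orthogonal complement of \<open>u\<close>; \<open>w\<close> shows that this sphere
  is nonempty. Since \<open>u\<close> is an eigenvector, the complement is invariant under
  \<open>L\<close>, and first-order optimality inside it makes \<open>v\<close> an
  eigenvector.\<close>

lemma constrained_minimum_eigenvalue:
  fixes L :: "real ^ 'n ^ 'n"
  assumes sym: "transpose L = L" and u: "L *v u = \<kappa> *\<^sub>R u"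
    and ex: "w \<bullet> u = 0" "w \<noteq> 0"
  obtains v \<mu> where "L *v v = \<mu> *\<^sub>R v" "v \<noteq> 0" "v \<bullet> u = 0"
    "\<forall>x. x \<bullet> u = 0 \<longrightarrow> \<mu> * (norm x)\<^sup>2 \<le> x \<bullet> (L *v x)"
proof -
  note symL = symmetric_matrix_inner[OF sym]
  define S where "S = {x :: real ^ 'n. x \<bullet> u = 0} \<inter> sphere 0 1"
  have "closed {x :: real ^ 'n. x \<bullet> u = 0}"
    by (intro closed_Collect_eq continuous_intros)
  then have "compact S"
    unfolding S_def by (simp add: closed_Int_compact)
  moreover have "(1 / norm w) *\<^sub>R w \<in> S"
    using ex by (simp add: S_def)
  then have "S \<noteq> {}"
    by blast
  moreover have "continuous_on S (\<lambda>x. x \<bullet> (L *v x))"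
    by (intro continuous_intros linear_continuous_on matrix_vector_mul_bounded_linear)
  ultimately obtain v where v: "v \<in> S" "\<And>x. x \<in> S \<Longrightarrow> v \<bullet> (L *v v) \<le> x \<bullet> (L *v x)"
    using continuous_attains_inf[of S "\<lambda>x. x \<bullet> (L *v x)"] by blast
  define \<mu> where "\<mu> = v \<bullet> (L *v v)"
  have nv: "norm v = 1" "v \<bullet> u = 0"
    using v(1) by (auto simp: S_def)
  have min: "\<mu> * (norm x)\<^sup>2 \<le> x \<bullet> (L *v x)" if "x \<bullet> u = 0" for x
  proof (cases "x = 0")
    case False
    have "(1 / norm x) *\<^sub>R x \<in> S"
      using that False by (simp add: S_def)
    from v(2)[OF this] have "\<mu> \<le> (x \<bullet> (L *v x)) / (norm x)\<^sup>2"
      by (simp add: \<mu>_def matrix_vector_mult_scaleR power2_eq_square)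
    then show ?thesis
      using False by (simp add: field_simps)
  qed simp
  \<comment> \<open>\<open>B v\<close> is the residual of the eigenvalue equation. By minimality,
    \<open>x \<bullet> B x\<close> is nonnegative on the complement of \<open>u\<close>, and it
    vanishes at \<open>v\<close>.\<close>
  define B where "B x = L *v x - \<mu> *\<^sub>R x" for x
  have Bsym: "x \<bullet> B y = y \<bullet> B x" for x y
    using symL[of x y] by (simp add: B_def inner_diff_right inner_commute)
  have Bv: "v \<bullet> B v = 0"
    using nv(1) by (simp add: B_def inner_diff_right \<mu>_def dot_square_norm)
  have Bu: "B v \<bullet> u = 0"
    using Bsym[of u v] u nv(2) by (simp add: B_def inner_diff_right inner_commute)
  \<comment> \<open>Perturbing \<open>v\<close> in the direction of its own residual, which is
    admissible by \<open>Bu\<close>, gives a linear term proportional to the squared norm of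
    \<open>B v\<close>.\<close>
  have quad: "0 \<le> 2 * s * (B v \<bullet> B v) + s\<^sup>2 * (B v \<bullet> B (B v))" for s
  proof -
    have "(v + s *\<^sub>R B v) \<bullet> u = 0"
      using nv(2) Bu by (simp add: inner_add_left)
    from min[OF this] have "0 \<le> (v + s *\<^sub>R B v) \<bullet> B (v + s *\<^sub>R B v)"
      by (simp add: B_def inner_diff_right dot_square_norm)
    also have "B (v + s *\<^sub>R B v) = B v + s *\<^sub>R B (B v)"
      by (simp add: B_def matrix_vector_right_distrib matrix_vector_mult_scaleR
          matrix_vector_mult_diff_distrib algebra_simps)
    also have "(v + s *\<^sub>R B v) \<bullet> (B v + s *\<^sub>R B (B v)) =
        2 * s * (B v \<bullet> B v) + s\<^sup>2 * (B v \<bullet> B (B v))"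
      using Bsym[of v "B v"] Bv by (simp add: inner_add_left inner_add_right power2_eq_square algebra_simps)
    finally show ?thesis .
  qed
  have "B v = 0"
  proof (rule ccontr)
    assume "B v \<noteq> 0"
    define a where "a = B v \<bullet> B v"
    define b where "b = \<bar>B v \<bullet> B (B v)\<bar>"
    have a: "a > 0" and b: "b \<ge> 0"
      using \<open>B v \<noteq> 0\<close> by (auto simp: a_def b_def)
    \<comment> \<open>A negative step so short that the quadratic term cannot compensate the linear
      one; the denominator \<open>b + 1\<close> also covers \<open>b = 0\<close>.\<close>
    define s where "s = - (a / (b + 1))"
    have s: "s < 0" "- s * b < a"
      using a b by (auto simp: s_def field_simps)
    have "0 \<le> 2 * s * a + s\<^sup>2 * b"
    proof -
      have "s\<^sup>2 * (B v \<bullet> B (B v)) \<le> s\<^sup>2 * b"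
        by (rule mult_left_mono) (auto simp: b_def)
      then show ?thesis
        using quad[of s] by (simp add: a_def)
    qed
    also have "\<dots> = s * (a + (a - (- s * b)))"
      by (simp add: power2_eq_square algebra_simps)
    also have "\<dots> < 0"
      using a s by (intro mult_neg_pos) auto
    finally show False by simp
  qed
  then have "L *v v = \<mu> *\<^sub>R v"
    by (simp add: B_def)
  then show ?thesis
    using that nv min by force
qed

section \<open>Squared deviation from the average and the second Laplacian eigenvalue\<close>

definition average :: "real ^ 'n \<Rightarrow> real" where
  "average x = (\<Sum>i\<in>UNIV. x $ i) / real CARD('n)"

definition disagreement :: "real ^ 'n \<Rightarrow> real" where
  "disagreement x = (\<Sum>i\<in>UNIV. (x $ i - average x)\<^sup>2)"

lemma disagreement_eq:
  fixes x :: "real ^ 'n"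
  shows "disagreement x = (\<Sum>i\<in>UNIV. (x $ i)\<^sup>2) - (\<Sum>i\<in>UNIV. x $ i)\<^sup>2 / real CARD('n)"
proof -
  have "disagreement x = (\<Sum>i\<in>UNIV. (x $ i)\<^sup>2 - 2 * average x * x $ i + (average x)\<^sup>2)"
    unfolding disagreement_def by (simp add: power2_diff algebra_simps)
  also have "\<dots> = (\<Sum>i\<in>UNIV. (x $ i)\<^sup>2) - 2 * average x * (\<Sum>i\<in>UNIV. x $ i)
      + real CARD('n) * (average x)\<^sup>2"
    by (simp add: sum.distrib sum_subtractf sum_distrib_left)
  also have "\<dots> = (\<Sum>i\<in>UNIV. (x $ i)\<^sup>2) - (\<Sum>i\<in>UNIV. x $ i)\<^sup>2 / real CARD('n)"
    by (simp add: average_def field_simps power2_eq_square)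
  finally show ?thesis .
qed

lemma disagreement_nonneg: "0 \<le> disagreement x"
  by (simp add: disagreement_def sum_nonneg)

text \<open>The form is a sum of nonnegative terms, so each term vanishes and \<open>x\<close>
  agrees at the two ends of every arc; agreement then passes along undirected paths.\<close>

lemma weakly_connected_laplacian_kernel:
  fixes A :: "real ^ 'n ^ 'n"
  assumes nonneg: "\<And>i j. 0 \<le> A $ i $ j"
    and conn: "weakly_connected (underlying_digraph A)"
    and zero: "x \<bullet> (gossip_laplacian A *v x) = 0"
  shows "x $ i = x $ j"
proof -
  have *: "\<forall>i j. A $ i $ j * (x $ i - x $ j)\<^sup>2 = 0"
    using zero unfolding gossip_laplacian_quadratic
    by (simp add: sum_nonneg_eq_0_iff sum_nonneg nonneg)
  have edge: "x $ u = x $ v" if "(u, v) \<in> underlying_digraph A \<union> (underlying_digraph A)\<inverse>" for u v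
    proof -
    have "A $ u $ v \<noteq> 0 \<or> A $ v $ u \<noteq> 0"
      using that by (auto simp: underlying_digraph_def)
    then show ?thesis
      using * by (metis eq_iff_diff_eq_0 mult_eq_0_iff zero_eq_power2)
  qed
  have "(i, j) \<in> (underlying_digraph A \<union> (underlying_digraph A)\<inverse>)\<^sup>*"
    using conn by (simp add: weakly_connected_def)
  then show ?thesis
    proof (induction rule: rtrancl_induct)
    case (step y z)
    then show ?case using edge by metis
  qed simp
qed

text \<open>The minimum \<open>\<mu>\<close> of the Rayleigh quotient on the complement of the
  all-ones vector is an eigenvalue. Eigenvectors for nonzero eigenvalues are orthogonal to the ones,
  so no nonzero eigenvalue lies below \<open>\<mu>\<close>. Connectedness makes \<open>\<mu>\<close>
  positive and 0 a simple eigenvalue, so \<open>\<mu>\<close> is the entry at index 1.\<close>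

lemma second_smallest_eigenvalue_gossip:
  fixes A :: "real ^ 'n ^ 'n"
  assumes card: "CARD('n) \<ge> 2"
    and nonneg: "\<And>i j. 0 \<le> A $ i $ j"
    and conn: "weakly_connected (underlying_digraph A)"
  shows second_smallest_eigenvalue_pos: "second_smallest_eigenvalue (gossip_laplacian A) > 0"
    and second_smallest_eigenvalue_le:
      "second_smallest_eigenvalue (gossip_laplacian A) * disagreement x
        \<le> (\<Sum>i\<in>UNIV. \<Sum>j\<in>UNIV. A $ i $ j * (x $ i - x $ j)\<^sup>2)"
proof -
  define L where "L = gossip_laplacian A"
  have sym: "transpose L = L"
    by (simp add: L_def transpose_gossip_laplacian)
  \<comment> \<open>In this vector type \<open>1\<close> is the vector with all entries 1, which
    spans the consensus states.\<close>
  define u :: "real ^ 'n" where "u = 1"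
  have u1: "u $ i = 1" for i by (simp add: u_def)
  have inner_u: "x \<bullet> u = (\<Sum>i\<in>UNIV. x $ i)" for x
    by (simp add: inner_vec_def u1)
  have u0: "L *v u = 0"
    by (simp add: L_def gossip_laplacian_mult vec_eq_iff u1)
  then have u0': "L *v u = 0 *\<^sub>R u"
    by simp
  have kernel: "x $ i = x $ j" if "x \<bullet> (L *v x) = 0" for x i j
    using weakly_connected_laplacian_kernel[OF nonneg conn] that by (simp add: L_def)
  have kernel0: "x = 0" if "x \<bullet> (L *v x) = 0" "x \<bullet> u = 0" for x
  proof -
    have "x $ i = 0" for i
    proof -
      have "(\<Sum>j\<in>UNIV. x $ j) = (\<Sum>j\<in>(UNIV :: 'n set). x $ i)"
        by (rule sum.cong[OF refl]) (rule kernel[OF that(1)])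
      then show ?thesis using that(2) by (simp add: inner_u)
    qed
    then show ?thesis by (simp add: vec_eq_iff)
  qed
  obtain i j :: 'n where ij: "i \<noteq> j"
  proof -
    have "\<not> CARD('n) \<le> Suc 0"
      using card by simp
    then show ?thesis
      using that by (auto simp: card_le_Suc0_iff_eq)
  qed
  define w :: "real ^ 'n" where "w = axis i 1 - axis j 1"
  have wu: "w \<bullet> u = 0"
    by (simp add: w_def inner_diff_left inner_axis' u1)
  have w0: "w \<noteq> 0"
    using ij by (auto simp: w_def axis_eq_axis)
  obtain \<mu> v where v: "L *v v = \<mu> *\<^sub>R v" "v \<noteq> 0" "v \<bullet> u = 0"
    and min: "\<forall>x. x \<bullet> u = 0 \<longrightarrow> \<mu> * (norm x)\<^sup>2 \<le> x \<bullet> (L *v x)"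
    by (rule constrained_minimum_eigenvalue[OF sym u0' wu w0]) blast
  have Q_nonneg: "0 \<le> x \<bullet> (L *v x)" for x
    by (simp add: L_def gossip_laplacian_quadratic sum_nonneg nonneg)
  have "\<mu> * (v \<bullet> v) = v \<bullet> (L *v v)" by (simp add: v(1))
  moreover have "v \<bullet> (L *v v) \<noteq> 0"
    using kernel0 v by blast
  ultimately have "0 < \<mu> * (v \<bullet> v)"
    using Q_nonneg[of v] by linarith
  then have \<mu>: "\<mu> > 0"
    by (rule zero_less_mult_pos2) (simp add: v(2))
  have ev: "\<nu> = 0 \<or> \<nu> = \<mu> \<or> \<mu> < \<nu>" if \<nu>: "\<nu> \<in> eigenvalues L" for \<nu>
  proof (rule ccontr)
    assume *: "\<not> ?thesis"
    obtain z where z: "L *v z = \<nu> *\<^sub>R z" "z \<noteq> 0"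
      using \<nu> by (auto simp: eigenvalues_def eigenspace_def)
    have "\<nu> * (z \<bullet> u) = 0"
      using symmetric_matrix_inner[OF sym, of z u] z u0 by simp
    then have "z \<bullet> u = 0"
      using * by simp
    from min[rule_format, OF this] have "\<mu> * (z \<bullet> z) \<le> \<nu> * (z \<bullet> z)"
      by (simp add: z(1) dot_square_norm)
    then show False using * z(2) by auto
  qed
  \<comment> \<open>A one-dimensional kernel means that 0 is listed exactly once, which moves the
    next eigenvalue to index 1.\<close>
  have E0: "eigenspace L 0 = span {u}"
  proof
    show "eigenspace L 0 \<subseteq> span {u}"
    proof
      fix x assume "x \<in> eigenspace L 0"
      then have "x \<bullet> (L *v x) = 0" by (simp add: eigenspace_def)
      then have "x = x $ i *\<^sub>R u"
        unfolding vec_eq_iff using kernel[of x] by (simp add: u1)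
      then show "x \<in> span {u}"
        by (metis span_base span_scale singletonI)
    qed
    show "span {u} \<subseteq> eigenspace L 0"
      using u0 by (auto simp: span_singleton eigenspace_def matrix_vector_mult_scaleR)
  qed
  have "u \<noteq> 0"
    by (simp add: u_def)
  then have dim0: "dim (eigenspace L 0) = 1"
    unfolding E0 by (simp add: dim_insert)
  have dim\<mu>: "dim (eigenspace L \<mu>) \<noteq> 0"
    using v by (auto simp: eigenspace_def)
  have in0: "0 \<in> eigenvalues L" and in\<mu>: "\<mu> \<in> eigenvalues L"
    using u0 \<open>u \<noteq> 0\<close> v by (auto simp: eigenvalues_def eigenspace_def)
  define R where "R = eigenvalues L - {0, \<mu>}"
  have finR: "finite R"
    using finite_eigenvalues[OF sym] by (simp add: R_def)
  have "sorted_list_of_set (eigenvalues L) = 0 # \<mu> # sorted_list_of_set R"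
  proof (rule sorted_distinct_set_unique)
    have "\<mu> < \<nu> \<and> 0 < \<nu>" if "\<nu> \<in> R" for \<nu>
      using that ev[of \<nu>] \<mu> by (auto simp: R_def)
    then show "sorted (0 # \<mu> # sorted_list_of_set R)" "distinct (0 # \<mu> # sorted_list_of_set R)"
      using finR \<mu> by (fastforce simp: less_imp_le)+
    show "set (sorted_list_of_set (eigenvalues L)) = set (0 # \<mu> # sorted_list_of_set R)"
      using finR finite_eigenvalues[OF sym] in0 in\<mu> by (auto simp: R_def)
  qed auto
  then have "eigenvalue_list L ! 1 = \<mu>"
    using dim0 dim\<mu> by (cases "dim (eigenspace L \<mu>)") (auto simp: eigenvalue_list_def)
  then have eq: "second_smallest_eigenvalue (gossip_laplacian A) = \<mu>"
    by (simp add: second_smallest_eigenvalue_def L_def)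
  show "second_smallest_eigenvalue (gossip_laplacian A) > 0"
    by (simp add: eq \<mu>)
  \<comment> \<open>The projection of \<open>x\<close> onto the complement of the ones: its squared
    norm is the disagreement, and the quadratic form does not see the constant that is
    subtracted.\<close>
  define y where "y = x - average x *\<^sub>R u"
  have yi: "y $ i = x $ i - average x" for i
    by (simp add: y_def u1)
  have "y \<bullet> u = 0"
    by (simp add: inner_u yi sum_subtractf average_def)
  then have "\<mu> * (norm y)\<^sup>2 \<le> (\<Sum>i\<in>UNIV. \<Sum>j\<in>UNIV. A $ i $ j * (x $ i - x $ j)\<^sup>2)"
    using min[rule_format, of y] by (simp add: L_def gossip_laplacian_quadratic yi)
  moreover have "(norm y)\<^sup>2 = disagreement x"
    unfolding power2_norm_eq_inner inner_vec_def disagreement_def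
    by (simp add: yi power2_eq_square)
  ultimately show "second_smallest_eigenvalue (gossip_laplacian A) * disagreement x
      \<le> (\<Sum>i\<in>UNIV. \<Sum>j\<in>UNIV. A $ i $ j * (x $ i - x $ j)\<^sup>2)"
    by (simp add: eq)
qed

section \<open>Expected decrease of the disagreement\<close>

lemma gossip_step_neither: "gossip_step s False False x = x"
  by (cases s) (simp add: gossip_step_def vec_eq_iff)

text \<open>A two-sided exchange replaces both entries by their midpoint. The total is preserved, so
  by \<open>disagreement_eq\<close> only the two squares matter, and these lose half the squared
  difference.\<close>

lemma disagreement_gossip_step:
  fixes x :: "real ^ 'n"
  shows "disagreement (gossip_step s True True x) =
    disagreement x - (x $ fst s - x $ snd s)\<^sup>2 / 2"
proof -
  obtain i j where s: "s = (i, j)" by (cases s)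
  define y where "y = gossip_step s True True x"
  have y: "y $ l = (if l = i \<or> l = j then (x $ i + x $ j) / 2 else x $ l)" for l
    by (auto simp: y_def s gossip_step_def add_divide_distrib)
  show ?thesis
  proof (cases "i = j")
    case True
    then have "y = x" by (auto simp: vec_eq_iff y)
    with True show ?thesis by (simp add: y_def s)
  next
    \<comment> \<open>Two distinct indices are needed to split their terms off the sum without
      counting one of them twice.\<close>
    case False
    have split: "(\<Sum>l\<in>UNIV. g l) = g i + g j + (\<Sum>l\<in>UNIV - {i, j}. g l)" for g :: "'n \<Rightarrow> real"
    proof -
      have "(\<Sum>l\<in>UNIV. g l) = (\<Sum>l\<in>{i, j}. g l) + (\<Sum>l\<in>UNIV - {i, j}. g l)"
        by (rule sum.subset_diff[THEN trans]) (auto simp: add.commute)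
      then show ?thesis using False by simp
    qed
    have rest: "(\<Sum>l\<in>UNIV - {i, j}. h (y $ l)) = (\<Sum>l\<in>UNIV - {i, j}. h (x $ l))" for h :: "real \<Rightarrow> real"
      by (rule sum.cong) (auto simp: y)
    have "(\<Sum>l\<in>UNIV. y $ l) = (\<Sum>l\<in>UNIV. x $ l)"
      using rest[of "\<lambda>z. z"] by (simp add: split y)
    moreover have "(\<Sum>l\<in>UNIV. (y $ l)\<^sup>2) = (\<Sum>l\<in>UNIV. (x $ l)\<^sup>2) - (x $ i - x $ j)\<^sup>2 / 2"
      using rest[of "\<lambda>z. z\<^sup>2"] by (simp add: split y) (simp add: power2_eq_square field_simps)
    ultimately show ?thesis
      unfolding y_def[symmetric] disagreement_eq by (simp add: s)
  qed
qed

text \<open>From each state one step has finitely many outcomes. Real functions of the state are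
  therefore bounded, which gives their integrability.\<close>

lemma finite_range_gossip_state:
  "finite (range (gossip_state sel Ep Em k0 (x0 :: real ^ 'n) t))"
proof (induction t)
  case (Suc t)
  have "range (gossip_state sel Ep Em k0 x0 (Suc t)) \<subseteq>
      (\<Union>s\<in>UNIV. \<Union>rp\<in>UNIV. \<Union>rm\<in>UNIV.
        gossip_step s rp rm ` range (gossip_state sel Ep Em k0 x0 t))"
  proof (rule image_subsetI)
    fix \<omega>
    show "gossip_state sel Ep Em k0 x0 (Suc t) \<omega> \<in> (\<Union>s\<in>UNIV. \<Union>rp\<in>UNIV. \<Union>rm\<in>UNIV.
        gossip_step s rp rm ` range (gossip_state sel Ep Em k0 x0 t))"
      unfolding gossip_state.simps by (rule UN_I[OF UNIV_I])+ (rule imageI, rule rangeI)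
  qed
  then show ?case
    by (rule finite_subset) (use Suc in simp)
qed simp

section \<open>Independence of the past, the current selection and the current communication\<close>

context unreliable_gossip
begin

text \<open>The family of assumption \<open>indep\<close> under a name: \<open>Inl k\<close> indexes
  the selection and \<open>Inr k\<close> the communication at time \<open>k\<close>.\<close>

definition generator :: "nat + nat \<Rightarrow> 'w set set" where
  "generator = case_sum (\<lambda>k. {sel k -` S \<inter> space M | S. True})
     (\<lambda>k. sigma_sets (space M) {Ep k, Em k})"

text \<open>The times are strictly below \<open>k\<close>: these sources of randomness determine the
  state at time \<open>k\<close>.\<close>

definition past :: "nat \<Rightarrow> (nat + nat) set" where
  "past k = Inl ` {..<k} \<union> Inr ` {..<k}"

lemma generator_Pow: "generator i \<subseteq> Pow (space M)"
proof (cases i)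
  case (Inr k)
  have "{Ep k, Em k} \<subseteq> Pow (space M)"
    using Ep_event[THEN sets.sets_into_space] Em_event[THEN sets.sets_into_space] by blast
  from sigma_sets_into_sp[OF this] show ?thesis
    by (auto simp: generator_def Inr)
qed (auto simp: generator_def)

text \<open>Stability under intersections is what allows independence to pass from the generators to
  the sigma-algebras generated by blocks of them.\<close>

lemma Int_stable_generator: "Int_stable (generator i)"
proof (cases i)
  case (Inl k)
  show ?thesis
  proof (rule Int_stableI)
    fix a b assume "a \<in> generator i" "b \<in> generator i"
    then obtain S T where "a = sel k -` S \<inter> space M" "b = sel k -` T \<inter> space M"
      by (auto simp: generator_def Inl)
    then have "a \<inter> b = sel k -` (S \<inter> T) \<inter> space M"
      by auto
    then show "a \<inter> b \<in> generator i"
      unfolding generator_def Inl sum.case by blast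
  qed
next
  case (Inr k)
  have "sigma_sets (space M) {Ep k, Em k} = sets (sigma (space M) {Ep k, Em k})"
    using Ep_event[THEN sets.sets_into_space] Em_event[THEN sets.sets_into_space] by simp
  then show ?thesis
    by (simp add: generator_def Inr sets.Int_stable)
qed

text \<open>Each update uses the preceding state, the selection and the two flags, all at times
  before \<open>k\<close>. States carry the discrete sigma-algebra, so any function of them can be
  composed freely.\<close>

lemma gossip_state_measurable_past:
  assumes "k0 + t \<le> k"
  shows "gossip_state sel Ep Em k0 x0 t
    \<in> sigma (space M) (\<Union>i\<in>past k. generator i) \<rightarrow>\<^sub>M count_space UNIV"
  using assms
proof (induction t)
  case (Suc t)
  define N where "N = sigma (space M) (\<Union>i\<in>past k. generator i)"
  define j where "j = k0 + t"
  have sets_N: "S \<in> sets N" if "i \<in> past k" "S \<in> generator i" for S i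
    using that generator_Pow by (auto simp: N_def)
  have space_N: "space N = space M"
    using generator_Pow by (auto simp: N_def space_measure_of_conv)
  have past: "Inl j \<in> past k" "Inr j \<in> past k"
    using Suc.prems by (auto simp: j_def past_def)
  have state: "gossip_state sel Ep Em k0 x0 t \<in> N \<rightarrow>\<^sub>M count_space UNIV"
    using Suc by (simp add: N_def)
  have sel: "sel j \<in> N \<rightarrow>\<^sub>M count_space UNIV"
    by (rule measurableI) (auto simp: space_N intro!: sets_N[OF past(1)], auto simp: generator_def)
  have E: "Ep j \<in> sets N" "Em j \<in> sets N"
    by (auto intro!: sets_N[OF past(2)], auto simp: generator_def)
  have E': "(\<lambda>\<omega>. \<omega> \<in> Ep j) \<in> N \<rightarrow>\<^sub>M count_space UNIV" "(\<lambda>\<omega>. \<omega> \<in> Em j) \<in> N \<rightarrow>\<^sub>M count_space UNIV"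
    using E by measurable
  have step: "(\<lambda>\<omega>. gossip_step s rp rm (gossip_state sel Ep Em k0 x0 t \<omega>)) \<in> N \<rightarrow>\<^sub>M count_space UNIV"
    for s rp rm
    by (rule measurable_compose[OF state]) simp
  \<comment> \<open>The fixed flags and the fixed pair become random one at a time, each ranging
    over countably many values.\<close>
  have "(\<lambda>\<omega>. gossip_step s rp (\<omega> \<in> Em j) (gossip_state sel Ep Em k0 x0 t \<omega>))
      \<in> N \<rightarrow>\<^sub>M count_space UNIV" for s rp
    by (rule measurable_compose_countable[OF step E'(2)])
  then have "(\<lambda>\<omega>. gossip_step s (\<omega> \<in> Ep j) (\<omega> \<in> Em j) (gossip_state sel Ep Em k0 x0 t \<omega>))
      \<in> N \<rightarrow>\<^sub>M count_space UNIV" for s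
    by (rule measurable_compose_countable[OF _ E'(1)])
  then have "(\<lambda>\<omega>. gossip_step (sel j \<omega>) (\<omega> \<in> Ep j) (\<omega> \<in> Em j) (gossip_state sel Ep Em k0 x0 t \<omega>))
      \<in> N \<rightarrow>\<^sub>M count_space UNIV"
    by (rule measurable_compose_countable'[OF _ sel]) (simp add: countable_finite)
  then show ?case
    by (simp add: N_def j_def)
next
  case 0
  have "gossip_state sel Ep Em k0 x0 0 = (\<lambda>_. x0)"
    by (simp add: fun_eq_iff)
  then show ?case by simp
qed

lemma indep_generator: "indep_sets generator UNIV"
  unfolding generator_def by (rule indep)

lemma generator_events: "generator i \<subseteq> events"
  using indep_generator unfolding indep_sets_def by blast

lemma sets_past_subset: "sets (sigma (space M) (\<Union>i\<in>past k. generator i)) \<subseteq> events"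
proof -
  have "(\<Union>i\<in>past k. generator i) \<subseteq> Pow (space M)"
    using generator_Pow by blast
  then have "sets (sigma (space M) (\<Union>i\<in>past k. generator i)) =
      sigma_sets (space M) (\<Union>i\<in>past k. generator i)"
    by (rule sets_measure_of)
  also have "\<dots> \<subseteq> events"
    using generator_events by (intro sets.sigma_sets_subset UN_least)
  finally show ?thesis .
qed

lemma gossip_state_measurable:
  "gossip_state sel Ep Em k0 x0 t \<in> M \<rightarrow>\<^sub>M count_space UNIV"
proof -
  have "gossip_state sel Ep Em k0 x0 t
      \<in> sigma (space M) (\<Union>i\<in>past (k0 + t). generator i) \<rightarrow>\<^sub>M count_space UNIV"
    by (rule gossip_state_measurable_past) simp
  moreover have "space (sigma (space M) (\<Union>i\<in>past (k0 + t). generator i)) = space M"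
    by (simp add: space_measure_of_conv)
  ultimately show ?thesis
    using sets_past_subset[of "k0 + t"] by (auto simp: measurable_def)
qed

lemma borel_measurable_gossip_state:
  fixes f :: "real ^ 'n \<Rightarrow> real"
  shows "(\<lambda>\<omega>. f (gossip_state sel Ep Em k0 x0 t \<omega>)) \<in> borel_measurable M"
  by (rule measurable_compose[OF gossip_state_measurable]) simp

lemma integrable_gossip_state:
  fixes f :: "real ^ 'n \<Rightarrow> real"
  shows "integrable M (\<lambda>\<omega>. f (gossip_state sel Ep Em k0 x0 t \<omega>))"
proof -
  have "finite ((\<lambda>x. \<bar>f x\<bar>) ` range (gossip_state sel Ep Em k0 x0 t))"
    using finite_range_gossip_state by blast
  then obtain B where "\<And>\<omega>. \<bar>f (gossip_state sel Ep Em k0 x0 t \<omega>)\<bar> \<le> B"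
    by (metis Max_ge image_eqI rangeI)
  then show ?thesis
    by (intro integrable_const_bound[of _ B] borel_measurable_gossip_state) auto
qed

lemma sel_event: "{\<omega> \<in> space M. sel k \<omega> = s} \<in> events"
proof -
  have "sel k -` {s} \<inter> space M \<in> events"
    using sel_rv[of k] by (rule measurable_sets) simp
  also have "sel k -` {s} \<inter> space M = {\<omega> \<in> space M. sel k \<omega> = s}"
    by auto
  finally show ?thesis .
qed

lemma sel_pair_prob:
  "prob {\<omega> \<in> space M. sel k \<omega> = s} = A $ fst s $ snd s / real CARD('n)"
  using sel_prob[of k "fst s" "snd s"] by simp

text \<open>The state is a function of the past, so the three factors are measurable over disjoint
  blocks of independent generators and the expectation of their product factorises.\<close>

lemma expectation_selection_communication:
  fixes f :: "real ^ 'n \<Rightarrow> real"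
  shows "expectation (\<lambda>\<omega>. indicator {\<omega> \<in> space M. sel (k0 + t) \<omega> = s} \<omega> * indicator (Ep (k0 + t)) \<omega>
      * f (gossip_state sel Ep Em k0 x0 t \<omega>)) =
    prob {\<omega> \<in> space M. sel (k0 + t) \<omega> = s} * Pp (k0 + t)
      * expectation (\<lambda>\<omega>. f (gossip_state sel Ep Em k0 x0 t \<omega>))"
proof -
  define k where "k = k0 + t"
  \<comment> \<open>Block 0 is the past, block 1 the current selection, block 2 the current
    communication; \<open>Y j\<close> is the factor that lives on block \<open>j\<close>.\<close>
  define I where "I = (\<lambda>j::nat. if j = 0 then past k else if j = 1 then {Inl k} else {Inr k})"
  define Y where "Y = (\<lambda>j::nat. if j = 0 then (\<lambda>\<omega>. f (gossip_state sel Ep Em k0 x0 t \<omega>))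
    else if j = 1 then indicator {\<omega> \<in> space M. sel k \<omega> = s} else indicator (Ep k) :: 'w \<Rightarrow> real)"
  define F where "F j = sigma_sets (space M) (\<Union>i\<in>I j. generator i)" for j
  have indep_F: "indep_sets F {0, 1, 2}"
    unfolding F_def
  proof (rule indep_sets_collect_sigma)
    show "indep_sets generator (\<Union>j\<in>{0, 1, 2}. I j)"
      using indep_generator by (rule indep_sets_mono_index[OF subset_UNIV])
    show "disjoint_family_on I {0, 1, 2}"
      by (auto simp: disjoint_family_on_def I_def past_def)
  qed (rule Int_stable_generator)
  have F_sets: "F j = sets (sigma (space M) (\<Union>i\<in>I j. generator i))" for j
    using generator_Pow by (auto simp: F_def UN_least)
  have meas: "Y j \<in> borel_measurable (sigma (space M) (\<Union>i\<in>I j. generator i))"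
    if j: "j \<in> {0, 1, 2}" for j
  proof -
    consider "j = 0" | "j = 1" | "j = 2" using j by auto
    then show ?thesis
    proof cases
      case 1
      then show ?thesis
        using measurable_compose[OF gossip_state_measurable_past[of k0 t k x0], of f borel]
        by (simp add: Y_def I_def k_def)
    next
      case 2
      have "{\<omega> \<in> space M. sel k \<omega> = s} \<in> generator (Inl k)"
        by (auto simp: generator_def intro!: exI[of _ "{s}"])
      then have "{\<omega> \<in> space M. sel k \<omega> = s} \<in> sets (sigma (space M) (generator (Inl k)))"
        using generator_Pow by simp
      then show ?thesis
        by (simp add: Y_def I_def 2 borel_measurable_indicator)
    next
      case 3
      have "Ep k \<in> generator (Inr k)"
        by (auto simp: generator_def)
      then have "Ep k \<in> sets (sigma (space M) (generator (Inr k)))"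
        using generator_Pow by simp
      then show ?thesis
        by (simp add: Y_def I_def 3 borel_measurable_indicator)
    qed
  qed
  have "indep_vars (\<lambda>_. borel) Y {0, 1, 2}"
    unfolding indep_vars_def2
  proof
    show "\<forall>j\<in>{0, 1, 2}. random_variable borel (Y j)"
      using sel_event[of k s] Ep_event[of k]
      by (auto simp: Y_def borel_measurable_gossip_state)
    show "indep_sets (\<lambda>j. {Y j -` A \<inter> space M |A. A \<in> sets borel}) {0, 1, 2}"
    proof (rule indep_sets_mono_sets[OF indep_F])
      fix j assume j: "j \<in> {0, 1, 2 :: nat}"
      have "Y j -` B \<inter> space M \<in> F j" if "B \<in> sets borel" for B
        using measurable_sets[OF meas[OF j] that] by (simp add: F_sets space_measure_of_conv)
      then show "{Y j -` B \<inter> space M |B. B \<in> sets borel} \<subseteq> F j"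
        by blast
    qed
  qed
  moreover have "integrable M (indicat_real S)" if "S \<in> events" for S
    using that by (intro integrable_real_indicator) (simp_all add: emeasure_eq_measure)
  then have "integrable M (Y j)" for j
    using sel_event[of k s] Ep_event[of k] integrable_gossip_state[of f k0 x0 t]
    by (simp add: Y_def)
  ultimately have "expectation (\<lambda>\<omega>. \<Prod>j\<in>{0, 1, 2}. Y j \<omega>) = (\<Prod>j\<in>{0, 1, 2}. expectation (Y j))"
    by (intro indep_vars_lebesgue_integral) auto
  then show ?thesis
    using sel_event[of k s] Ep_event[of k] Ep_prob[of k]
    by (simp add: Y_def k_def mult_ac)
qed

text \<open>Summing the independent contributions of all pairs weights half of each squared
  difference by \<open>A $ i $ j / n\<close> for the selection and by \<open>Pp\<close> for the
  communication, where \<open>n\<close> is the number of nodes.\<close>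

lemma expected_disagreement_step:
  assumes dep: "perfectly_dependent M Ep Em"
  shows "expectation (\<lambda>\<omega>. disagreement (gossip_state sel Ep Em k0 x0 (Suc t) \<omega>)) =
    expectation (\<lambda>\<omega>. disagreement (gossip_state sel Ep Em k0 x0 t \<omega>))
    - Pp (k0 + t) / (2 * real CARD('n)) *
      expectation (\<lambda>\<omega>. \<Sum>i\<in>UNIV. \<Sum>j\<in>UNIV. A $ i $ j *
        (gossip_state sel Ep Em k0 x0 t \<omega> $ i - gossip_state sel Ep Em k0 x0 t \<omega> $ j)\<^sup>2)"
proof -
  define X where "X = gossip_state sel Ep Em k0 x0 t"
  define k where "k = k0 + t"
  define d where "d s x = (x $ fst s - x $ snd s)\<^sup>2 / 2" for s and x :: "real ^ 'n"
  define Z where "Z s \<omega> = indicator {\<omega> \<in> space M. sel k \<omega> = s} \<omega> * indicator (Ep k) \<omega> * d s (X \<omega>)" for s \<omega>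
  have int_X: "integrable M (\<lambda>\<omega>. f (X \<omega>))" for f :: "real ^ 'n \<Rightarrow> real"
    unfolding X_def by (rule integrable_gossip_state)
  have int_Z: "integrable M (Z s)" for s
  proof -
    have "Z s = (\<lambda>\<omega>. indicator ({\<omega> \<in> space M. sel k \<omega> = s} \<inter> Ep k) \<omega> *\<^sub>R d s (X \<omega>))"
      by (auto simp: Z_def fun_eq_iff indicator_def)
    then show ?thesis
      using integrable_mult_indicator[OF sets.Int[OF sel_event[of k s] Ep_event[of k]] int_X[of "d s"]]
      by simp
  qed
  \<comment> \<open>Outside a null set the two flags agree, so a step is either a full exchange or
    no change at all. Among the terms \<open>Z s\<close> only the selected pair can
    contribute.\<close>
  have "AE \<omega> in M. disagreement (gossip_state sel Ep Em k0 x0 (Suc t) \<omega>) =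
      disagreement (X \<omega>) - (\<Sum>s\<in>UNIV. Z s \<omega>)"
    using dep[unfolded perfectly_dependent_def, rule_format, of k] AE_space
  proof eventually_elim
    case (elim \<omega>)
    have "(\<Sum>s\<in>UNIV. Z s \<omega>) = (\<Sum>s\<in>UNIV. if s = sel k \<omega> then indicator (Ep k) \<omega> * d s (X \<omega>) else 0)"
      using elim(2) by (intro sum.cong) (auto simp: Z_def)
    also have "\<dots> = indicator (Ep k) \<omega> * d (sel k \<omega>) (X \<omega>)"
      by simp
    finally show ?case
      using elim(1) by (cases "\<omega> \<in> Ep k")
        (simp_all add: X_def k_def d_def disagreement_gossip_step gossip_step_neither)
  qed
  then have "expectation (\<lambda>\<omega>. disagreement (gossip_state sel Ep Em k0 x0 (Suc t) \<omega>)) =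
      expectation (\<lambda>\<omega>. disagreement (X \<omega>) - (\<Sum>s\<in>UNIV. Z s \<omega>))"
    by (rule integral_cong_AE[rotated 2])
      (auto intro!: borel_measurable_gossip_state borel_measurable_diff borel_measurable_sum
        borel_measurable_integrable[OF int_Z] borel_measurable_integrable[OF int_X]
        simp del: gossip_state.simps)
  also have "\<dots> = expectation (\<lambda>\<omega>. disagreement (X \<omega>)) - (\<Sum>s\<in>UNIV. expectation (Z s))"
    by (subst Bochner_Integration.integral_diff) (use int_Z in \<open>auto intro: int_X\<close>)
  also have "(\<Sum>s\<in>UNIV. expectation (Z s)) =
      (\<Sum>s\<in>UNIV. prob {\<omega> \<in> space M. sel k \<omega> = s} * Pp k * expectation (\<lambda>\<omega>. d s (X \<omega>)))"
    unfolding Z_def X_def k_def by (simp add: expectation_selection_communication)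
  also have "\<dots> = (\<Sum>i\<in>UNIV. \<Sum>j\<in>UNIV.
      1 / real CARD('n) * A $ i $ j * Pp k * (expectation (\<lambda>\<omega>. (X \<omega> $ i - X \<omega> $ j)\<^sup>2) / 2))"
    by (simp add: sum.cartesian_product sel_pair_prob d_def case_prod_beta
        flip: UNIV_Times_UNIV)
  also have "\<dots> = Pp k / (2 * real CARD('n)) * (\<Sum>i\<in>UNIV. \<Sum>j\<in>UNIV.
      A $ i $ j * expectation (\<lambda>\<omega>. (X \<omega> $ i - X \<omega> $ j)\<^sup>2))"
    unfolding sum_distrib_left by (intro sum.cong refl) (simp add: mult_ac)
  also have "(\<Sum>i\<in>UNIV. \<Sum>j\<in>UNIV. A $ i $ j * expectation (\<lambda>\<omega>. (X \<omega> $ i - X \<omega> $ j)\<^sup>2)) =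
      expectation (\<lambda>\<omega>. \<Sum>i\<in>UNIV. \<Sum>j\<in>UNIV. A $ i $ j * (X \<omega> $ i - X \<omega> $ j)\<^sup>2)"
  proof -
    have "integrable M (\<lambda>\<omega>. A $ i $ j * (X \<omega> $ i - X \<omega> $ j)\<^sup>2)" for i j
      by (rule int_X)
    then show ?thesis by (simp add: integrable_sum)
  qed
  finally show ?thesis
    by (simp add: X_def k_def)
qed

end

text \<open>A trace bound: the variational inequality is added up over all unit vectors. Each has
  disagreement \<open>1 - 1/n\<close>, and on the right every entry of \<open>A\<close> is counted
  at most twice, while the entries of \<open>A\<close> sum to \<open>n\<close>.\<close>

lemma second_smallest_eigenvalue_upper:
  fixes A :: "real ^ 'n ^ 'n"
  assumes card: "CARD('n) \<ge> 2" and A: "stochastic_matrix A"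
    and conn: "weakly_connected (underlying_digraph A)"
  shows "second_smallest_eigenvalue (gossip_laplacian A) * (real CARD('n) - 1) \<le> 2 * real CARD('n)"
proof -
  define \<mu> where "\<mu> = second_smallest_eigenvalue (gossip_laplacian A)"
  have nonneg: "0 \<le> A $ i $ j" and row: "(\<Sum>j\<in>UNIV. A $ i $ j) = 1" for i j
    using A by (auto simp: stochastic_matrix_def)
  define e where "e i = (axis i 1 :: real ^ 'n)" for i
  have e: "e i $ j = (if j = i then 1 else 0)" for i j
    by (simp add: e_def axis_def)
  have dis: "disagreement (e i) = 1 - 1 / real CARD('n)" for i
    by (simp add: disagreement_eq e if_distrib[of "\<lambda>z. z\<^sup>2"] cong: if_cong)
  have "\<mu> * (real CARD('n) - 1) = (\<Sum>i\<in>UNIV. \<mu> * disagreement (e i))"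
    unfolding dis by (simp add: field_simps)
  also have "\<dots> \<le> (\<Sum>i\<in>UNIV. \<Sum>j\<in>UNIV. \<Sum>l\<in>UNIV. A $ j $ l * (e i $ j - e i $ l)\<^sup>2)"
    unfolding \<mu>_def by (intro sum_mono second_smallest_eigenvalue_le card nonneg conn)
  also have "\<dots> = (\<Sum>j\<in>UNIV. \<Sum>i\<in>UNIV. \<Sum>l\<in>UNIV. A $ j $ l * (e i $ j - e i $ l)\<^sup>2)"
    by (rule sum.swap)
  also have "\<dots> = (\<Sum>j\<in>UNIV. \<Sum>l\<in>UNIV. \<Sum>i\<in>UNIV. A $ j $ l * (e i $ j - e i $ l)\<^sup>2)"
    by (intro sum.cong refl sum.swap)
  \<comment> \<open>The entries are 0 or 1, so the squared difference is at most the sum, with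
    strict inequality only for diagonal terms.\<close>
  also have "\<dots> \<le> (\<Sum>j\<in>UNIV. \<Sum>l\<in>UNIV. \<Sum>i\<in>UNIV. A $ j $ l * (e i $ j + e i $ l))"
    by (intro sum_mono mult_left_mono nonneg) (auto simp: e)
  also have "\<dots> = (\<Sum>j\<in>UNIV. \<Sum>l\<in>UNIV. A $ j $ l * 2)"
    by (simp add: sum_distrib_left[symmetric] sum.distrib e)
  also have "\<dots> = 2 * real CARD('n)"
    by (simp add: sum_distrib_right[symmetric] row)
  finally show ?thesis
    by (simp add: \<mu>_def)
qed

text \<open>The bound follows from \<open>y \<le> \<rho> * exp ((y - \<rho>) / \<rho>)\<close> for each factor.\<close>

lemma prod_le_power_of_sum_le:
  fixes y :: "'b \<Rightarrow> real"
  assumes "\<And>i. i \<in> I \<Longrightarrow> 0 \<le> y i" "(\<Sum>i\<in>I. y i) \<le> real (card I) * \<rho>" "\<rho> > 0"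
  shows "(\<Prod>i\<in>I. y i) \<le> \<rho> ^ card I"
proof (cases "finite I")
  case True
  have "y i \<le> \<rho> * exp ((y i - \<rho>) / \<rho>)" for i
  proof -
    have "\<rho> * (1 + (y i - \<rho>) / \<rho>) \<le> \<rho> * exp ((y i - \<rho>) / \<rho>)"
      using assms(3) by (intro mult_left_mono exp_ge_add_one_self) auto
    then show ?thesis using assms(3) by (simp add: field_simps)
  qed
  then have "(\<Prod>i\<in>I. y i) \<le> (\<Prod>i\<in>I. \<rho> * exp ((y i - \<rho>) / \<rho>))"
    by (intro prod_mono) (auto simp: assms(1))
  also have "\<dots> = \<rho> ^ card I * exp ((\<Sum>i\<in>I. y i - \<rho>) / \<rho>)"
    by (simp add: prod.distrib exp_sum[OF True] sum_divide_distrib)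
  also have "\<dots> \<le> \<rho> ^ card I * 1"
    using assms(2,3) by (intro mult_left_mono) (auto simp: sum_subtractf divide_le_0_iff)
  finally show ?thesis by simp
qed simp

section \<open>Bounds on the computation time\<close>

lemma spread_ge: "x $ i - x $ j \<le> spread x"
  unfolding spread_def by (intro diff_mono Max_ge Min_le) auto

lemma spread_attained:
  fixes x :: "real ^ 'n"
  obtains i j where "spread x = x $ i - x $ j"
proof -
  have "Max (range (\<lambda>i. x $ i)) \<in> range (\<lambda>i. x $ i)" "Min (range (\<lambda>i. x $ i)) \<in> range (\<lambda>i. x $ i)"
    by (auto intro!: Max_in Min_in)
  then show ?thesis
    using that unfolding spread_def by fastforce
qed

lemma spread_square_le: "(spread x)\<^sup>2 \<le> 4 * disagreement x"
proof -
  obtain i j where ij: "spread x = x $ i - x $ j"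
    by (rule spread_attained)
  have le: "(x $ l - average x)\<^sup>2 \<le> disagreement x" for l
    unfolding disagreement_def by (rule member_le_sum) auto
  have "(x $ i - x $ j)\<^sup>2 \<le> 2 * (x $ i - average x)\<^sup>2 + 2 * (x $ j - average x)\<^sup>2"
    using zero_le_power2[of "(x $ i - average x) + (x $ j - average x)"]
    by (simp add: power2_eq_square algebra_simps)
  then show ?thesis
    unfolding ij using le[of i] le[of j] by linarith
qed

text \<open>The average lies between the smallest and the largest entry, so every entry is within
  one spread of it.\<close>

lemma disagreement_le_spread:
  fixes x :: "real ^ 'n"
  shows "disagreement x \<le> real CARD('n) * (spread x)\<^sup>2"
proof -
  obtain i0 j0 where ij: "spread x = x $ i0 - x $ j0"
    by (rule spread_attained)
  have "(\<Sum>i\<in>UNIV. x $ i) \<le> (\<Sum>i\<in>(UNIV :: 'n set). x $ i0)"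
    using spread_ge[of x _ j0] ij by (intro sum_mono) auto
  moreover have "(\<Sum>i\<in>(UNIV :: 'n set). x $ j0) \<le> (\<Sum>i\<in>UNIV. x $ i)"
    using spread_ge[of x i0] ij by (intro sum_mono) (auto simp: algebra_simps)
  ultimately have avg: "x $ j0 \<le> average x" "average x \<le> x $ i0"
    by (simp_all add: average_def pos_le_divide_eq pos_divide_le_eq mult.commute)
  have "(x $ i - average x)\<^sup>2 \<le> (spread x)\<^sup>2" for i
  proof -
    have "x $ j0 \<le> x $ i" "x $ i \<le> x $ i0"
      using spread_ge[of x i0 i] spread_ge[of x i j0] ij by auto
    then have "\<bar>x $ i - average x\<bar> \<le> \<bar>spread x\<bar>"
      using avg ij by auto
    then show ?thesis by (simp only: abs_le_square_iff)
  qed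
  then have "disagreement x \<le> (\<Sum>i\<in>(UNIV :: 'n set). (spread x)\<^sup>2)"
    unfolding disagreement_def by (rule sum_mono)
  then show ?thesis by simp
qed

lemma gossip_step_equal:
  assumes "x $ fst s = x $ snd s"
  shows "gossip_step s rp rm x = x"
  using assms by (cases s) (auto simp: gossip_step_def vec_eq_iff)

section \<open>Decay of the disagreement and bounds on the computation time\<close>

context unreliable_gossip
begin

lemma T_com_leI:
  assumes "\<And>k0 x0. spread x0 > 0 \<Longrightarrow> \<exists>t. real t \<le> B \<and>
    prob {\<omega> \<in> space M. spread (gossip_state sel Ep Em k0 x0 t \<omega>) / spread x0 \<ge> \<epsilon>} \<le> \<epsilon>"
  shows "T_com M sel Ep Em \<epsilon> \<le> ereal B"
  unfolding T_com_def
proof (rule SUP_least, safe)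
  fix k0 :: nat and x0 :: "real ^ 'n" assume "spread x0 > 0"
  from assms[OF this, of k0] obtain t where
    t: "real t \<le> B" "prob {\<omega> \<in> space M. spread (gossip_state sel Ep Em k0 x0 t \<omega>) / spread x0 \<ge> \<epsilon>} \<le> \<epsilon>"
    by blast
  have "(INF t\<in>{t. prob {\<omega> \<in> space M. \<epsilon> \<le> spread (gossip_state sel Ep Em k0 x0 t \<omega>) / spread x0} \<le> \<epsilon>}.
      ereal (real t)) \<le> ereal (real t)"
    by (rule INF_lower) (use t in simp)
  also have "\<dots> \<le> ereal B" using t by simp
  finally show "(INF t\<in>{t. prob {\<omega> \<in> space M. \<epsilon> \<le> spread (gossip_state sel Ep Em k0 x0 t \<omega>) / spread x0} \<le> \<epsilon>}.
      ereal (real t)) \<le> ereal B" .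
qed

text \<open>One start bounds the supremum from below. If no \<open>t\<close> is admissible, the
  infimum is infinite and the bound still holds.\<close>

lemma le_T_comI:
  assumes "spread x0 > 0"
    and "\<And>t. prob {\<omega> \<in> space M. spread (gossip_state sel Ep Em k0 x0 t \<omega>) / spread x0 \<ge> \<epsilon>} \<le> \<epsilon>
      \<Longrightarrow> B \<le> real t"
  shows "ereal B \<le> T_com M sel Ep Em \<epsilon>"
proof -
  have "ereal B \<le> (INF t\<in>{t. prob {\<omega> \<in> space M. \<epsilon> \<le> spread (gossip_state sel Ep Em k0 x0 t \<omega>) / spread x0} \<le> \<epsilon>}.
      ereal (real t))"
    using assms(2) by (intro INF_greatest) auto
  also have "\<dots> \<le> T_com M sel Ep Em \<epsilon>"
    unfolding T_com_def using assms(1) by (intro SUP_upper2[of "(k0, x0)"]) auto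
  finally show ?thesis .
qed

lemma spread_event:
  "{\<omega> \<in> space M. spread (gossip_state sel Ep Em k0 x0 t \<omega>) / spread x0 \<ge> \<epsilon>} \<in> events"
proof -
  have "gossip_state sel Ep Em k0 x0 t -` {x. spread x / spread x0 \<ge> \<epsilon>} \<inter> space M \<in> events"
    by (rule measurable_sets[OF gossip_state_measurable]) simp
  also have "gossip_state sel Ep Em k0 x0 t -` {x. spread x / spread x0 \<ge> \<epsilon>} \<inter> space M =
      {\<omega> \<in> space M. spread (gossip_state sel Ep Em k0 x0 t \<omega>) / spread x0 \<ge> \<epsilon>}"
    by auto
  finally show ?thesis .
qed

text \<open>The factor \<open>1/n\<close> comes from drawing a node, the 1/2 from the loss in one
  exchange; \<open>contraction * Pp k\<close> is the guaranteed relative decrease of the expected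
  disagreement at time \<open>k\<close>.\<close>

abbreviation "contraction \<equiv> second_smallest_eigenvalue (gossip_laplacian A) / (2 * real CARD('n))"

lemma A_nonneg: "0 \<le> A $ i $ j"
  using stochastic by (simp add: stochastic_matrix_def)

lemma contraction_pos:
  assumes "CARD('n) \<ge> 2" "weakly_connected (underlying_digraph A)"
  shows "0 < contraction"
  using second_smallest_eigenvalue_pos[OF assms(1) A_nonneg assms(2)] by simp

text \<open>For at least three nodes the trace bound gives \<open>\<mu> * 2 \<le> 2 * n\<close>.
  This keeps all contraction factors at least 1/2, hence positive.\<close>

lemma contraction_le_half:
  assumes "CARD('n) \<ge> 3" "weakly_connected (underlying_digraph A)"
  shows "contraction \<le> 1 / 2"
proof -
  define \<mu> where "\<mu> = second_smallest_eigenvalue (gossip_laplacian A)"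
  have \<mu>: "\<mu> > 0"
    unfolding \<mu>_def using second_smallest_eigenvalue_pos[OF _ A_nonneg assms(2)] assms(1) by simp
  have "\<mu> * 2 \<le> \<mu> * (real CARD('n) - 1)"
    using \<mu> assms(1) by (intro mult_left_mono) auto
  also have "\<dots> \<le> 2 * real CARD('n)"
    unfolding \<mu>_def using assms by (intro second_smallest_eigenvalue_upper stochastic) auto
  finally show ?thesis
    by (simp add: \<mu>_def[symmetric])
qed

lemma expected_disagreement_contracts:
  assumes card: "CARD('n) \<ge> 2" and conn: "weakly_connected (underlying_digraph A)"
    and dep: "perfectly_dependent M Ep Em"
  shows "expectation (\<lambda>\<omega>. disagreement (gossip_state sel Ep Em k0 x0 (Suc t) \<omega>)) \<le>
    (1 - contraction * Pp (k0 + t)) * expectation (\<lambda>\<omega>. disagreement (gossip_state sel Ep Em k0 x0 t \<omega>))"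
proof -
  define X where "X = gossip_state sel Ep Em k0 x0 t"
  have int_X: "integrable M (\<lambda>\<omega>. f (X \<omega>))" for f :: "real ^ 'n \<Rightarrow> real"
    unfolding X_def by (rule integrable_gossip_state)
  define Q where "Q x = (\<Sum>i\<in>UNIV. \<Sum>j\<in>UNIV. A $ i $ j * (x $ i - x $ j)\<^sup>2)" for x :: "real ^ 'n"
  have "second_smallest_eigenvalue (gossip_laplacian A) * expectation (\<lambda>\<omega>. disagreement (X \<omega>)) =
      expectation (\<lambda>\<omega>. second_smallest_eigenvalue (gossip_laplacian A) * disagreement (X \<omega>))"
    by simp
  also have "\<dots> \<le> expectation (\<lambda>\<omega>. Q (X \<omega>))"
    using second_smallest_eigenvalue_le[OF card A_nonneg conn]
    by (intro integral_mono integrable_mult_right int_X) (simp add: Q_def)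
  finally have "Pp (k0 + t) / (2 * real CARD('n)) *
      (second_smallest_eigenvalue (gossip_laplacian A) * expectation (\<lambda>\<omega>. disagreement (X \<omega>)))
      \<le> Pp (k0 + t) / (2 * real CARD('n)) * expectation (\<lambda>\<omega>. Q (X \<omega>))"
    using Pp_range[of "k0 + t"] by (intro mult_left_mono) auto
  then show ?thesis
    unfolding expected_disagreement_step[OF dep]
    by (simp add: X_def Q_def algebra_simps)
qed

lemma expected_disagreement_le_prod:
  assumes card: "CARD('n) \<ge> 3" and conn: "weakly_connected (underlying_digraph A)"
    and dep: "perfectly_dependent M Ep Em"
  shows "expectation (\<lambda>\<omega>. disagreement (gossip_state sel Ep Em k0 x0 t \<omega>)) \<le>
    (\<Prod>s<t. 1 - contraction * Pp (k0 + s)) * disagreement x0"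
proof (induction t)
  case (Suc t)
  have card2: "CARD('n) \<ge> 2" using card by simp
  \<comment> \<open>The factor is thereby nonnegative, so the induction hypothesis may be multiplied
    by it.\<close>
  have "contraction * Pp (k0 + t) \<le> 1 / 2 * 1"
    using Pp_range[of "k0 + t"] contraction_le_half[OF card conn] by (intro mult_mono) auto
  then have "(1 - contraction * Pp (k0 + t)) * expectation (\<lambda>\<omega>. disagreement (gossip_state sel Ep Em k0 x0 t \<omega>))
      \<le> (1 - contraction * Pp (k0 + t)) * ((\<Prod>s<t. 1 - contraction * Pp (k0 + s)) * disagreement x0)"
    by (intro mult_left_mono Suc) simp
  with expected_disagreement_contracts[OF card2 conn dep, of k0 x0 t] show ?case
    by (simp add: mult_ac del: gossip_state.simps)
qed (simp add: prob_space)

text \<open>Only sums of \<open>Pp\<close> over windows are controlled, so the product of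
  contraction factors is cut into blocks of length \<open>T\<close>. In each block the factors have
  mean at most \<open>\<rho>\<close>, and \<open>prod_le_power_of_sum_le\<close>, a form of the
  arithmetic-geometric mean inequality, bounds their product.\<close>

lemma expected_disagreement_block:
  assumes card: "CARD('n) \<ge> 3" and conn: "weakly_connected (underlying_digraph A)"
    and dep: "perfectly_dependent M Ep Em"
    and T: "T \<ge> 1" and p: "\<And>m. p \<le> (\<Sum>k=m..<m+T. Pp k)"
    and \<rho>: "\<rho> = 1 - contraction * p / real T"
  shows "1 / 2 \<le> \<rho>"
    and "expectation (\<lambda>\<omega>. disagreement (gossip_state sel Ep Em k0 x0 (q * T) \<omega>)) \<le>
      \<rho> ^ (q * T) * disagreement x0"
proof -
  define c where "c = contraction"
  have c: "0 < c" "c \<le> 1 / 2"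
    using contraction_pos[OF _ conn] contraction_le_half[OF card conn] card by (auto simp: c_def)
  have "p \<le> real T"
    using p[of 0] sum_mono[of "{0..<T}" Pp "\<lambda>_. 1"] Pp_range by auto
  then have "c * (p / real T) \<le> c * 1"
    using T c by (intro mult_left_mono) auto
  then have "c * p / real T \<le> 1 / 2"
    using c(2) unfolding times_divide_eq_right by linarith
  then show half: "1 / 2 \<le> \<rho>"
    unfolding \<rho> c_def[symmetric] by linarith
  have cP: "c * Pp k \<le> 1" for k
    using mult_mono[of c "1/2" "Pp k" 1] c Pp_range[of k] by auto
  have block: "(\<Prod>s=m*T..<m*T+T. 1 - c * Pp (k0 + s)) \<le> \<rho> ^ T" for m
  proof -
    \<comment> \<open>Elapsed times are shifted to absolute ones. The hypothesis covers windows from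
      every starting time, so the rate does not depend on \<open>k0\<close>.\<close>
    have "(\<Sum>s=m*T..<m*T+T. Pp (k0 + s)) = (\<Sum>k=k0+m*T..<k0+m*T+T. Pp k)"
      using sum.shift_bounds_nat_ivl[of Pp "m*T" k0 "m*T+T"] by (simp add: add_ac)
    then have "p \<le> (\<Sum>s=m*T..<m*T+T. Pp (k0 + s))"
      using p by simp
    then have "(\<Sum>s=m*T..<m*T+T. 1 - c * Pp (k0 + s)) \<le> real T * \<rho>"
      using T c unfolding \<rho> c_def[symmetric]
      by (simp add: sum_subtractf sum_distrib_left[symmetric] algebra_simps)
    then have "(\<Prod>s=m*T..<m*T+T. 1 - c * Pp (k0 + s)) \<le> \<rho> ^ card {m*T..<m*T+T}"
      using half cP by (intro prod_le_power_of_sum_le) auto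
    then show ?thesis by simp
  qed
  have "(\<Prod>s<q*T. 1 - c * Pp (k0 + s)) = (\<Prod>m<q. \<Prod>s=m*T..<m*T+T. 1 - c * Pp (k0 + s))"
    by (rule prod.nat_group[symmetric])
  also have "\<dots> \<le> (\<Prod>m<q. \<rho> ^ T)"
    using cP by (intro prod_mono conjI block prod_nonneg) auto
  also have "\<dots> = \<rho> ^ (q * T)"
    by (simp add: power_mult[symmetric] mult.commute)
  finally have "(\<Prod>s<q*T. 1 - c * Pp (k0 + s)) * disagreement x0 \<le> \<rho> ^ (q * T) * disagreement x0"
    by (rule mult_right_mono) (rule disagreement_nonneg)
  with expected_disagreement_le_prod[OF card conn dep, of k0 x0 "q * T"]
  show "expectation (\<lambda>\<omega>. disagreement (gossip_state sel Ep Em k0 x0 (q * T) \<omega>)) \<le>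
      \<rho> ^ (q * T) * disagreement x0"
    by (simp add: c_def)
qed

text \<open>Markov's inequality for the disagreement, with the two comparisons between spread and
  disagreement used at the current and at the initial state; the initial spread cancels.\<close>

lemma prob_spread_ratio_le:
  assumes "spread x0 > 0" "\<epsilon> > 0"
    and bound: "expectation (\<lambda>\<omega>. disagreement (gossip_state sel Ep Em k0 x0 t \<omega>)) \<le> r * disagreement x0"
    and "r \<ge> 0"
  shows "prob {\<omega> \<in> space M. spread (gossip_state sel Ep Em k0 x0 t \<omega>) / spread x0 \<ge> \<epsilon>}
    \<le> 4 * real CARD('n) * r / \<epsilon>\<^sup>2"
proof -
  define X where "X = gossip_state sel Ep Em k0 x0 t"
  define c where "c = (\<epsilon> * spread x0)\<^sup>2 / 4"
  have c: "c > 0" using assms by (simp add: c_def)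
  have V_meas: "(\<lambda>\<omega>. disagreement (X \<omega>)) \<in> borel_measurable M"
    unfolding X_def by (rule borel_measurable_gossip_state)
  have "prob {\<omega> \<in> space M. spread (X \<omega>) / spread x0 \<ge> \<epsilon>} \<le> prob {\<omega> \<in> space M. disagreement (X \<omega>) \<ge> c}"
  proof (rule finite_measure_mono)
    show "{\<omega> \<in> space M. spread (X \<omega>) / spread x0 \<ge> \<epsilon>} \<subseteq> {\<omega> \<in> space M. disagreement (X \<omega>) \<ge> c}"
    proof safe
      fix \<omega> assume "\<epsilon> \<le> spread (X \<omega>) / spread x0"
      then have "\<epsilon> * spread x0 \<le> spread (X \<omega>)"
        using assms(1) by (simp add: field_simps)
      then have "(\<epsilon> * spread x0)\<^sup>2 \<le> (spread (X \<omega>))\<^sup>2"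
        using assms(1,2) by (intro power_mono) auto
      then show "c \<le> disagreement (X \<omega>)"
        using spread_square_le[of "X \<omega>"] by (simp add: c_def)
    qed
    show "{\<omega> \<in> space M. disagreement (X \<omega>) \<ge> c} \<in> events"
      using V_meas by measurable
  qed
  also have "\<dots> \<le> expectation (\<lambda>\<omega>. disagreement (X \<omega>)) / c"
    by (rule integral_Markov_inequality_measure[where A = "{}"])
      (use c integrable_gossip_state in \<open>auto simp: X_def disagreement_nonneg\<close>)
  also have "\<dots> \<le> (r * (real CARD('n) * (spread x0)\<^sup>2)) / c"
    using bound mult_left_mono[OF disagreement_le_spread[of x0] assms(4)] c
    by (intro divide_right_mono) (auto simp: X_def)
  also have "\<dots> = 4 * real CARD('n) * r / \<epsilon>\<^sup>2"
    using assms(1) by (simp add: c_def power_mult_distrib field_simps)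
  finally show ?thesis by (simp add: X_def)
qed

text \<open>It suffices that \<open>4 * n * \<rho> ^ t / \<epsilon>^2 \<le> \<epsilon>\<close>, and
  taking logarithms gives the time. The additive term is independent of the start, as the supremum
  requires, and of \<open>\<epsilon>\<close>.\<close>

lemma T_com_upper:
  assumes card: "CARD('n) \<ge> 3" and conn: "weakly_connected (underlying_digraph A)"
    and dep: "perfectly_dependent M Ep Em"
    and p0: "p > 0" and T: "T \<ge> 1" and p: "\<And>m. p \<le> (\<Sum>k=m..<m+T. Pp k)"
    and \<rho>: "\<rho> = 1 - contraction * p / real T"
    and \<epsilon>: "0 < \<epsilon>" "\<epsilon> < 1"
  shows "T_com M sel Ep Em \<epsilon> \<le> ereal (3 * inverse (ln (inverse \<rho>)) * ln (inverse \<epsilon>)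
    + (ln (4 * real CARD('n)) / ln (inverse \<rho>) + real T))"
proof (rule T_com_leI)
  fix k0 :: nat and x0 :: "real ^ 'n" assume x0: "spread x0 > 0"
  note block = expected_disagreement_block[OF card conn dep T p \<rho>]
  have "0 < contraction * p / real T"
    using contraction_pos[OF _ conn] card p0 T by (intro divide_pos_pos[OF mult_pos_pos]) auto
  then have \<rho>_bounds: "0 < \<rho>" "\<rho> < 1"
    using block(1) unfolding \<rho> by linarith+
  define \<gamma> where "\<gamma> = ln (inverse \<rho>)"
  have \<gamma>: "\<gamma> > 0"
    using \<rho>_bounds by (simp add: \<gamma>_def ln_inverse)
  \<comment> \<open>The real time at which \<open>\<rho>\<close> to the power \<open>y\<close>
    equals \<open>\<epsilon> ^ 3 / (4 * n)\<close>.\<close>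
  define y where "y = (3 * ln (inverse \<epsilon>) + ln (4 * real CARD('n))) / \<gamma>"
  \<comment> \<open>The decay is available at the ends of complete windows, so \<open>y\<close> is
    rounded up to a multiple of \<open>T\<close>, at an additive cost of at most
    \<open>T\<close>.\<close>
  define q where "q = nat \<lceil>y / real T\<rceil>"
  have "y \<ge> 0"
    unfolding y_def using \<epsilon> \<gamma> card by (intro divide_nonneg_pos add_nonneg_nonneg) (auto simp: ln_inverse)
  then have "0 \<le> y / real T"
    by simp
  then have "y / real T \<le> real q" "real q \<le> y / real T + 1"
    unfolding q_def by linarith+
  then have q: "y \<le> real (q * T)" "real (q * T) \<le> y + real T"
    using T by (simp_all add: field_simps)
  have "\<rho> ^ (q * T) = exp (ln \<rho>) ^ (q * T)"
    using \<rho>_bounds by simp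
  also have "\<dots> = exp (real (q * T) * ln \<rho>)"
    by (rule exp_of_nat_mult[symmetric])
  also have "\<dots> = exp (- \<gamma> * real (q * T))"
    using \<rho>_bounds by (simp add: \<gamma>_def ln_inverse mult.commute)
  also have "\<dots> \<le> exp (- \<gamma> * y)"
    using q \<gamma> by simp
  also have "- \<gamma> * y = 3 * ln \<epsilon> - ln (4 * real CARD('n))"
    using \<gamma> \<epsilon> by (simp add: y_def ln_inverse)
  also have "exp (3 * ln \<epsilon> - ln (4 * real CARD('n))) = \<epsilon> ^ 3 / (4 * real CARD('n))"
    using \<epsilon> by (simp add: exp_diff exp_of_nat_mult[of 3, simplified])
  finally have small: "\<rho> ^ (q * T) \<le> \<epsilon> ^ 3 / (4 * real CARD('n))" .
  have "prob {\<omega> \<in> space M. spread (gossip_state sel Ep Em k0 x0 (q * T) \<omega>) / spread x0 \<ge> \<epsilon>}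
      \<le> 4 * real CARD('n) * \<rho> ^ (q * T) / \<epsilon>\<^sup>2"
    using \<rho>_bounds by (intro prob_spread_ratio_le x0 \<epsilon> block) simp
  also have "\<dots> \<le> 4 * real CARD('n) * (\<epsilon> ^ 3 / (4 * real CARD('n))) / \<epsilon>\<^sup>2"
    by (intro divide_right_mono mult_left_mono small) auto
  also have "\<dots> = \<epsilon>"
    using \<epsilon> by (simp add: power2_eq_square power3_eq_cube)
  finally have "prob {\<omega> \<in> space M. spread (gossip_state sel Ep Em k0 x0 (q * T) \<omega>) / spread x0 \<ge> \<epsilon>} \<le> \<epsilon>" .
  moreover have "y + real T = 3 * inverse (ln (inverse \<rho>)) * ln (inverse \<epsilon>)
      + (ln (4 * real CARD('n)) / ln (inverse \<rho>) + real T)"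
    by (simp add: y_def \<gamma>_def[symmetric] divide_inverse algebra_simps)
  ultimately show "\<exists>t. real t \<le> 3 * inverse (ln (inverse \<rho>)) * ln (inverse \<epsilon>)
      + (ln (4 * real CARD('n)) / ln (inverse \<rho>) + real T) \<and>
    prob {\<omega> \<in> space M. spread (gossip_state sel Ep Em k0 x0 t \<omega>) / spread x0 \<ge> \<epsilon>} \<le> \<epsilon>"
    using q(2) by metis
qed

text \<open>With positive probability the same arc is selected \<open>t\<close> times in a row, and then a unit
  vector supported away from this arc does not move.\<close>

lemma T_com_lower:
  assumes card: "CARD('n) \<ge> 3" and conn: "weakly_connected (underlying_digraph A)"
  shows "\<exists>c>0. \<forall>\<epsilon>\<in>{0<..<1}. ereal (c * ln (inverse \<epsilon>)) \<le> T_com M sel Ep Em \<epsilon>"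
proof -
  \<comment> \<open>If only self-loops had positive weight, undirected paths could not join distinct
    nodes.\<close>
  obtain i j where ij: "i \<noteq> j" "A $ i $ j > 0"
  proof -
    have "\<not> CARD('n) \<le> Suc 0" using card by simp
    then obtain u v :: 'n where uv: "u \<noteq> v"
      by (auto simp: card_le_Suc0_iff_eq)
    show ?thesis
    proof (rule ccontr)
      assume "\<not> thesis"
      then have *: "i = j" if "A $ i $ j > 0" for i j
        using \<open>\<And>j i. i \<noteq> j \<Longrightarrow> 0 < A $ i $ j \<Longrightarrow> thesis\<close> that by blast
      have "(u, v) \<in> (underlying_digraph A \<union> (underlying_digraph A)\<inverse>)\<^sup>*"
        using conn by (simp add: weakly_connected_def)
      then have "u = v"
        by (induction rule: rtrancl_induct) (auto simp: underlying_digraph_def dest: *)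
      then show False using uv by simp
    qed
  qed
  obtain l where l: "l \<notin> {i, j}"
  proof -
    have "card {i, j} < CARD('n)"
      using card ij by simp
    then have "{i, j} \<noteq> UNIV" by (metis less_irrefl)
    then show ?thesis using that by blast
  qed
  define a where "a = A $ i $ j / real CARD('n)"
  have "A $ i $ j \<le> (\<Sum>j\<in>UNIV. A $ i $ j)"
    by (rule member_le_sum) (auto simp: A_nonneg)
  then have "A $ i $ j \<le> 1"
    using stochastic by (simp add: stochastic_matrix_def)
  then have a: "0 < a" "a < 1"
    using ij card by (auto simp: a_def divide_less_eq)
  \<comment> \<open>Entries \<open>i\<close> and \<open>j\<close> are both 0, so an exchange along
    the chosen arc leaves this state fixed whether or not messages arrive.\<close>
  define x0 :: "real ^ 'n" where "x0 = axis l 1"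
  have x0: "x0 $ l = 1" "x0 $ i = 0" "x0 $ j = 0"
    using l by (auto simp: x0_def axis_def)
  have spread: "spread x0 > 0"
    using spread_ge[of x0 l i] x0 by simp
  have stay: "gossip_state sel Ep Em 0 x0 t \<omega> = x0" if "\<And>s. s < t \<Longrightarrow> sel s \<omega> = (i, j)" for t \<omega>
    using that by (induction t) (auto simp: gossip_step_equal x0)
  have run: "prob {\<omega> \<in> space M. \<forall>s<t. sel s \<omega> = (i, j)} = a ^ t" for t
  \<comment> \<open>The product rule for independent sets is applied to a nonempty index set, so the
    empty run is treated separately.\<close>
  proof (cases "t = 0")
    case False
    define B where "B = case_sum (\<lambda>s. {\<omega> \<in> space M. sel s \<omega> = (i, j)}) (\<lambda>_ :: nat. {})"
    have "prob (\<Inter>s\<in>Inl ` {..<t}. B s) = (\<Prod>s\<in>Inl ` {..<t}. prob (B s))"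
    proof (rule indep_setsD[OF indep_generator])
      show "\<forall>s\<in>Inl ` {..<t}. B s \<in> generator s"
        by (auto simp: B_def generator_def intro!: exI[of _ "{(i, j)}"])
    qed (use False in auto)
    also have "\<dots> = a ^ t"
      by (simp add: prod.reindex B_def sel_pair_prob a_def)
    also have "(\<Inter>s\<in>Inl ` {..<t}. B s) = {\<omega> \<in> space M. \<forall>s<t. sel s \<omega> = (i, j)}"
      using False by (auto simp: B_def)
    finally show ?thesis .
  qed (simp add: prob_space)
  have lower: "ereal (1 / ln (inverse a) * ln (inverse \<epsilon>)) \<le> T_com M sel Ep Em \<epsilon>"
    if \<epsilon>: "\<epsilon> \<in> {0<..<1}" for \<epsilon>
  proof (rule le_T_comI[OF spread, where ?k0.0 = 0])
    fix t
    assume "prob {\<omega> \<in> space M. spread (gossip_state sel Ep Em 0 x0 t \<omega>) / spread x0 \<ge> \<epsilon>} \<le> \<epsilon>"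
    moreover have "prob {\<omega> \<in> space M. \<forall>s<t. sel s \<omega> = (i, j)} \<le>
        prob {\<omega> \<in> space M. spread (gossip_state sel Ep Em 0 x0 t \<omega>) / spread x0 \<ge> \<epsilon>}"
      using stay \<epsilon> spread by (intro finite_measure_mono spread_event) auto
    ultimately have "a ^ t \<le> \<epsilon>"
      by (simp add: run)
    then have "ln (a ^ t) \<le> ln \<epsilon>"
      using a \<epsilon> by (subst ln_le_cancel_iff) auto
    then have "- ln \<epsilon> \<le> real t * (- ln a)"
      using a by (simp add: ln_realpow)
    moreover have "0 < - ln a"
      using a by simp
    ultimately have "- ln \<epsilon> / (- ln a) \<le> real t"
      by (simp only: pos_divide_le_eq)
    then show "1 / ln (inverse a) * ln (inverse \<epsilon>) \<le> real t"
      using a \<epsilon> by (simp add: ln_inverse)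
  qed
  then show ?thesis
    using a by (intro exI[of _ "1 / ln (inverse a)"]) (auto simp: ln_inverse)
qed

text \<open>By the union bound over times and both directions, a quiet window of length
  \<open>T\<close> passes without communication with probability at least 1/2, which exceeds
  \<open>\<epsilon>\<close>. Started at the beginning of that window, the state is frozen throughout
  it, so no time below \<open>T\<close> is admissible. The start may depend on \<open>T\<close>
  because the computation time is a supremum over starts.\<close>

lemma T_com_infinite:
  assumes card: "CARD('n) \<ge> 2"
    and quiet: "\<And>T::nat. \<exists>m. (\<Sum>k=m..<m+T. Pp k + Pm k) \<le> 1 / 2"
    and \<epsilon>: "0 < \<epsilon>" "\<epsilon> < 1 / 2"
  shows "T_com M sel Ep Em \<epsilon> = \<infinity>"
proof -
  have "\<not> CARD('n) \<le> Suc 0" using card by simp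
  then obtain u v :: 'n where uv: "u \<noteq> v"
    by (auto simp: card_le_Suc0_iff_eq)
  define x0 :: "real ^ 'n" where "x0 = axis u 1"
  have spread: "spread x0 > 0"
    using spread_ge[of x0 u v] uv by (simp add: x0_def axis_def)
  have ge: "ereal (real T) \<le> T_com M sel Ep Em \<epsilon>" for T
  proof -
    obtain m where m: "(\<Sum>k=m..<m+T. Pp k + Pm k) \<le> 1 / 2"
      using quiet by blast
    define C where "C = (\<Union>k\<in>{m..<m+T}. Ep k \<union> Em k)"
    have C: "C \<in> events"
      unfolding C_def using Ep_event Em_event by (intro sets.finite_UN sets.Un) auto
    have "prob C \<le> (\<Sum>k=m..<m+T. prob (Ep k \<union> Em k))"
      unfolding C_def using Ep_event Em_event by (intro finite_measure_subadditive_finite) auto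
    also have "\<dots> \<le> (\<Sum>k=m..<m+T. Pp k + Pm k)"
    proof (rule sum_mono)
      fix k
      show "prob (Ep k \<union> Em k) \<le> Pp k + Pm k"
        using measure_Un_le[OF Ep_event Em_event, of k k] by (simp add: Ep_prob Em_prob)
    qed
    finally have half: "1 / 2 \<le> prob (space M - C)"
      using m by (simp add: prob_compl[OF C])
    have stay: "gossip_state sel Ep Em m x0 t \<omega> = x0" if "\<omega> \<notin> C" "t \<le> T" for t \<omega>
      using that by (induction t) (auto simp: C_def gossip_step_neither)
    show ?thesis
    proof (rule le_T_comI[OF spread, where ?k0.0 = m])
      fix t
      assume le: "prob {\<omega> \<in> space M. spread (gossip_state sel Ep Em m x0 t \<omega>) / spread x0 \<ge> \<epsilon>} \<le> \<epsilon>"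
      show "real T \<le> real t"
      proof (rule ccontr)
        assume "\<not> real T \<le> real t"
        then have "prob (space M - C) \<le>
            prob {\<omega> \<in> space M. spread (gossip_state sel Ep Em m x0 t \<omega>) / spread x0 \<ge> \<epsilon>}"
          using stay \<epsilon> spread by (intro finite_measure_mono spread_event) auto
        then show False using half le \<epsilon> by linarith
      qed
    qed
  qed
  show ?thesis
  proof (rule ereal_top)
    fix B :: real
    obtain T :: nat where "B \<le> real T"
      using real_arch_simple by blast
    then have "ereal B \<le> ereal (real T)"
      by simp
    then show "ereal B \<le> T_com M sel Ep Em \<epsilon>"
      using ge by (rule order_trans)
  qed
qed

end

section \<open>From bounds on the computation time to its logarithmic order\<close>

text \<open>The quotient is eventually between \<open>c\<close> and \<open>C\<close>, so its limit
  superior is a real number, and \<open>c > 0\<close> keeps it away from 0.\<close>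

lemma limsup_orderI:
  assumes "c > 0" "\<forall>\<^sub>F \<epsilon> in at_right 0. g \<epsilon> > 0"
    and "\<forall>\<^sub>F \<epsilon> in at_right 0. ereal (c * g \<epsilon>) \<le> f \<epsilon>"
    and "\<forall>\<^sub>F \<epsilon> in at_right 0. f \<epsilon> \<le> ereal (C * g \<epsilon>)"
  shows "limsup_order f g"
proof -
  define L where "L = Limsup (at_right 0) (\<lambda>\<epsilon>. f \<epsilon> / ereal (g \<epsilon>))"
  have "ereal c \<le> L"
    unfolding L_def
  proof (rule le_Limsup)
    show "\<forall>\<^sub>F \<epsilon> in at_right 0. ereal c \<le> f \<epsilon> / ereal (g \<epsilon>)"
      using assms(2,3) by eventually_elim (simp add: ereal_le_divide_pos mult.commute)
  qed simp
  moreover have "L \<le> ereal C"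
    unfolding L_def
  proof (rule Limsup_bounded)
    show "\<forall>\<^sub>F \<epsilon> in at_right 0. f \<epsilon> / ereal (g \<epsilon>) \<le> ereal C"
      using assms(2,4) by eventually_elim (simp add: ereal_divide_le_pos mult.commute)
  qed
  ultimately obtain l where "L = ereal l" "c \<le> l"
    by (cases L) auto
  then show ?thesis
    using assms(1) unfolding limsup_order_def L_def by (intro exI[of _ l]) auto
qed

lemma not_limsup_order_infinite:
  assumes "\<forall>\<^sub>F \<epsilon> in at_right 0. f \<epsilon> = \<infinity>" "\<forall>\<^sub>F \<epsilon> in at_right 0. g \<epsilon> > 0"
  shows "\<not> limsup_order f g"
proof -
  have "\<forall>\<^sub>F \<epsilon> in at_right 0. f \<epsilon> / ereal (g \<epsilon>) = \<infinity>"
    using assms by eventually_elim simp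
  then have "Limsup (at_right 0) (\<lambda>\<epsilon>. f \<epsilon> / ereal (g \<epsilon>)) = Limsup (at_right (0::real)) (\<lambda>_. \<infinity>)"
    by (rule Limsup_eq)
  then show ?thesis
    by (simp add: limsup_order_def Limsup_const)
qed

theorem theorem2:
  fixes M :: "'w measure"
    and A :: "real ^ 'n ^ 'n"
    and Pp Pm P :: "nat \<Rightarrow> real"
    and sel :: "nat \<Rightarrow> 'w \<Rightarrow> 'n \<times> 'n"
    and Ep Em :: "nat \<Rightarrow> 'w set"
  assumes "CARD('n) \<ge> 3"
    and "unreliable_gossip M A Pp Pm sel Ep Em"
    and "weakly_connected (underlying_digraph A)"
    and "perfectly_dependent M Ep Em"
    and "\<And>k. P k = Pp k" and "\<And>k. P k = Pm k"
  shows "(global_as_consensus M sel Ep Em \<longleftrightarrow>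
            (\<exists>p>0. \<exists>T\<ge>1. \<forall>m. (\<Sum>k=m..<m+T. P k) \<ge> p)) \<and>
         (\<forall>(p::real) (T::nat). p > 0 \<longrightarrow> T \<ge> 1 \<longrightarrow> (\<forall>m. (\<Sum>k=m..<m+T. P k) \<ge> p) \<longrightarrow>
            (\<exists>r :: real \<Rightarrow> real. r \<in> O[at_right 0](\<lambda>_. 1) \<and>
               (\<forall>\<epsilon>\<in>{0<..<1}. T_com M sel Ep Em \<epsilon> \<le>
                  ereal (3 * inverse (ln (inverse (1 -
                            second_smallest_eigenvalue (gossip_laplacian A) * p
                              / (2 * real CARD('n) * real T))))
                         * ln (inverse \<epsilon>) + r \<epsilon>))))"
proof -
  interpret unreliable_gossip M A Pp Pm sel Ep Em by fact
  have P: "P = Pp" "Pm = Pp"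
    using assms(5,6) by (auto simp: fun_eq_iff)
  \<comment> \<open>A single constant \<open>R\<close> serves all \<open>\<epsilon>\<close>; it
    later provides both the bounded remainder and the order estimate.\<close>
  have bound: "\<exists>R. \<forall>\<epsilon>\<in>{0<..<1}. T_com M sel Ep Em \<epsilon> \<le>
      ereal (3 * inverse (ln (inverse (1 - second_smallest_eigenvalue (gossip_laplacian A) * p
                              / (2 * real CARD('n) * real T)))) * ln (inverse \<epsilon>) + R)"
    if "p > 0" "T \<ge> 1" "\<forall>m. (\<Sum>k=m..<m+T. P k) \<ge> p" for p :: real and T :: nat
  proof -
    have "1 - second_smallest_eigenvalue (gossip_laplacian A) * p / (2 * real CARD('n) * real T) =
        1 - contraction * p / real T"
      by simp
    then show ?thesis
      using T_com_upper[OF assms(1,3,4) that(1,2)] that(3) unfolding P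
      by (metis greaterThanLessThan_iff)
  qed
  have ln_pos: "\<forall>\<^sub>F \<epsilon> in at_right 0. 0 < ln (inverse \<epsilon> :: real)"
    and unit: "\<forall>\<^sub>F \<epsilon> in at_right (0::real). \<epsilon> \<in> {0<..<1}"
    and half: "\<forall>\<^sub>F \<epsilon> in at_right (0::real). \<epsilon> \<in> {0<..<1/2}"
    and ln_ge1: "\<forall>\<^sub>F \<epsilon> in at_right 0. 1 \<le> ln (inverse \<epsilon> :: real)"
  proof -
    show unit: "\<forall>\<^sub>F \<epsilon> in at_right (0::real). \<epsilon> \<in> {0<..<1}"
      by (rule eventually_at_right_real) simp
    show "\<forall>\<^sub>F \<epsilon> in at_right (0::real). \<epsilon> \<in> {0<..<1/2}"
      by (rule eventually_at_right_real) simp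
    have "\<forall>\<^sub>F \<epsilon> in at_right (0::real). \<epsilon> \<in> {0<..<exp (-1)}"
      by (rule eventually_at_right_real) simp
    then show ge1: "\<forall>\<^sub>F \<epsilon> in at_right 0. 1 \<le> ln (inverse \<epsilon> :: real)"
    proof eventually_elim
      case (elim \<epsilon>)
      then have "ln \<epsilon> \<le> ln (exp (-1))"
        by (subst ln_le_cancel_iff) auto
      then show ?case using elim by (simp add: ln_inverse)
    qed
    then show "\<forall>\<^sub>F \<epsilon> in at_right 0. 0 < ln (inverse \<epsilon> :: real)"
      by eventually_elim linarith
  qed
  have "global_as_consensus M sel Ep Em \<longleftrightarrow> (\<exists>p>0. \<exists>T\<ge>1. \<forall>m. (\<Sum>k=m..<m+T. P k) \<ge> p)"
  proof
    assume "\<exists>p>0. \<exists>T\<ge>1. \<forall>m. (\<Sum>k=m..<m+T. P k) \<ge> p"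
    then obtain K R where upper: "\<And>\<epsilon>. \<epsilon> \<in> {0<..<1} \<Longrightarrow> T_com M sel Ep Em \<epsilon> \<le> ereal (K * ln (inverse \<epsilon>) + R)"
      using bound by metis
    obtain c where c: "c > 0"
      and lower: "\<And>\<epsilon>. \<epsilon> \<in> {0<..<1} \<Longrightarrow> ereal (c * ln (inverse \<epsilon>)) \<le> T_com M sel Ep Em \<epsilon>"
      using T_com_lower[OF assms(1,3)] by blast
    show "global_as_consensus M sel Ep Em"
      unfolding global_as_consensus_def
    proof (rule limsup_orderI[OF c ln_pos])
      show "\<forall>\<^sub>F \<epsilon> in at_right 0. ereal (c * ln (inverse \<epsilon>)) \<le> T_com M sel Ep Em \<epsilon>"
        using unit by eventually_elim (rule lower)
      show "\<forall>\<^sub>F \<epsilon> in at_right 0. T_com M sel Ep Em \<epsilon> \<le> ereal ((K + \<bar>R\<bar>) * ln (inverse \<epsilon>))"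
        using unit ln_ge1
      proof eventually_elim
        case (elim \<epsilon>)
        \<comment> \<open>Once the logarithm is at least 1, it absorbs the additive
          constant.\<close>
        have "R \<le> \<bar>R\<bar> * ln (inverse \<epsilon>)"
          using mult_left_mono[OF elim(2), of "\<bar>R\<bar>"] by simp
        then have "ereal (K * ln (inverse \<epsilon>) + R) \<le> ereal ((K + \<bar>R\<bar>) * ln (inverse \<epsilon>))"
          by (simp add: algebra_simps)
        with upper[OF elim(1)] show ?case
          by (rule order_trans)
      qed
    qed
  next
    assume consensus: "global_as_consensus M sel Ep Em"
    show "\<exists>p>0. \<exists>T\<ge>1. \<forall>m. (\<Sum>k=m..<m+T. P k) \<ge> p"
    proof (rule ccontr)
      assume none: "\<not> ?thesis"
      have quiet: "\<exists>m. (\<Sum>k=m..<m+T. Pp k + Pm k) \<le> 1 / 2" for T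
      proof (cases "T \<ge> 1")
        case True
        \<comment> \<open>The negated condition is used with \<open>p = 1/4\<close>, since both
          directions together double the sum to at most 1/2.\<close>
        then have "\<exists>m. (\<Sum>k=m..<m+T. P k) < 1 / 4"
          using none[simplified, rule_format, of "1 / 4" T] by (auto simp: not_le)
        then obtain m where "(\<Sum>k=m..<m+T. P k) < 1 / 4" ..
        then have "(\<Sum>k=m..<m+T. Pp k + Pm k) \<le> 1 / 2"
          unfolding P sum.distrib by linarith
        then show ?thesis ..
      qed (auto simp: not_le)
      have "\<forall>\<^sub>F \<epsilon> in at_right 0. T_com M sel Ep Em \<epsilon> = \<infinity>"
        using half
      proof eventually_elim
        case (elim \<epsilon>)
        then show ?case
          using assms(1) by (intro T_com_infinite quiet) auto
      qed
      from not_limsup_order_infinite[OF this ln_pos] show False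
        using consensus by (simp add: global_as_consensus_def)
    qed
  qed
  moreover have "\<exists>r :: real \<Rightarrow> real. r \<in> O[at_right 0](\<lambda>_. 1) \<and>
      (\<forall>\<epsilon>\<in>{0<..<1}. T_com M sel Ep Em \<epsilon> \<le>
        ereal (3 * inverse (ln (inverse (1 - second_smallest_eigenvalue (gossip_laplacian A) * p
                              / (2 * real CARD('n) * real T)))) * ln (inverse \<epsilon>) + r \<epsilon>))"
    if pT: "p > 0" "T \<ge> 1" "\<forall>m. (\<Sum>k=m..<m+T. P k) \<ge> p" for p :: real and T :: nat
  proof -
    obtain R where "\<forall>\<epsilon>\<in>{0<..<1}. T_com M sel Ep Em \<epsilon> \<le>
        ereal (3 * inverse (ln (inverse (1 - second_smallest_eigenvalue (gossip_laplacian A) * p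
                              / (2 * real CARD('n) * real T)))) * ln (inverse \<epsilon>) + R)"
      using bound[OF pT] by blast
    then show ?thesis
      by (intro exI[of _ "\<lambda>_. R"] conjI) auto
  qed
  ultimately show ?thesis by blast
qed

end
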